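(* Let $0<d<\pi/2$, $\mathscr{D}_d=\{\zeta\in\mathbb{C}:|\Im\zeta|<d\}$, $\mathscr{D}_d^{-}=\{\zeta\in\mathscr{D}_d:\Re\zeta<0\}$, $\mathscr{D}_d^{+}=\{\zeta\in\mathscr{D}_d:\Re\zeta\ge0\}$, and $\psi(t)=\sinh[(\pi/2)\sinh t]$. Assume $f$ is analytic on $\psi(\mathscr{D}_d)$ and there are constants $K,\alpha,\beta>0$ with $|f(z)|\le K|1+z^2|^{-(\alpha+1)/2}$ for $z\in\psi(\mathscr{D}_d^-)$ and $|f(z)|\le K|1+z^2|^{-(\beta+1)/2}$ for $z\in\psi(\mathscr{D}_d^+)$. Let $\mu=\min\{\alpha,\beta\}$, $\nu=\max\{\alpha,\beta\}$, let $n$ be a positive integer, $h=\log(4dn/\mu)/n$, and let $M=n$, $N=n-\lfloor\log(\beta/\alpha)/h\rfloor$ if $\mu=\alpha$, and $N=n$, $M=n-\lfloor\log(\alpha/\beta)/h\rfloor$ if $\mu=\beta$. Suppose $n\ge\nu e/(4d)$, $Mh\ge x_{\alpha/2}$, $Nh\ge x_{\beta/2}$. Then \[ \sup_{\tau\in\mathbb{R}}\left|\int_{-\infty}^{\tau}f(t)\,dt-\sum_{k=-M}^{N}f(\psi(kh))\psi'(kh)J(k,h)(\psi^{-1}(\tau))\right|\le C_1\,\frac{e^{-\pi dn/\log(4dn/\mu)}\log(4dn/\mu)}{n}, \] with $C_1=\frac{2^{\nu+1}K}{\mu d}\left\{\frac{1}{(1-e^{-\pi\mu e/2})\{\cos(\frac\pi2\sin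 d)\}^{\nu}\cos d}+e^{\pi(\alpha+\beta)/4}\right\}$.
   Context: $J(k,h)(x)=h\left\{\frac12+\frac1\pi\operatorname{Si}[\pi(x/h-k)]\right\}$ with $\operatorname{Si}(x)=\int_0^x\frac{\sin\sigma}{\sigma}d\sigma$. For $\gamma>0$, $x_\gamma=\operatorname{arcsinh}\!\left(\frac{\sqrt{1+\sqrt{1-(2\pi\gamma)^2}}}{2\pi\gamma}\right)$ if $0<\gamma<1/(2\pi)$, and $x_\gamma=\operatorname{arcsinh}(1)$ if $\gamma\ge1/(2\pi)$. *)

theory Defs
  imports "HOL-Analysis.Analysis" "HOL-Probability.Sinc_Integral"
begin

definition J :: "int \<Rightarrow> real \<Rightarrow> real \<Rightarrow> real" where
  "J k h x = h * (1/2 + Si (pi * (x / h - real_of_int k)) / pi)"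

definition xg :: "real \<Rightarrow> real" where
  "xg \<gamma> = (if \<gamma> < 1 / (2*pi)
     then arsinh (sqrt (1 + sqrt (1 - (2*pi*\<gamma>)^2)) / (2*pi*\<gamma>))
     else arsinh 1)"

definition psi :: "complex \<Rightarrow> complex" where
  "psi z = sinh (complex_of_real (pi/2) * sinh z)"

definition psi_r :: "real \<Rightarrow> real" where
  "psi_r t = sinh ((pi/2) * sinh t)"

definition psi_inv :: "real \<Rightarrow> real" where
  "psi_inv x = arsinh ((2/pi) * arsinh x)"

definition strip :: "real \<Rightarrow> complex set" where
  "strip d = {z. \<bar>Im z\<bar> < d}"

definition strip_minus :: "real \<Rightarrow> complex set" where
  "strip_minus d = {z \<in> strip d. Re z < 0}"

definition strip_plus :: "real \<Rightarrow> complex set" where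
  "strip_plus d = {z \<in> strip d. Re z \<ge> 0}"

end

theory Submission
  imports Defs "HOL-Complex_Analysis.Complex_Analysis" "HOL-Real_Asymp.Real_Asymp"
begin

text \<open>
  Substituting \<open>t = psi s\<close> turns the integral into that of \<open>g = (f \<circ> psi) * psi'\<close>, which is
  holomorphic on the strip and decays double exponentially. The residue theorem on a rectangle
  represents \<open>g\<close> minus its cardinal series as \<open>sin (\<pi>t/h) / (2\<pi>\<i>)\<close> times the contour integral of
  \<open>g z / ((z - t) sin (\<pi>z/h))\<close>. Integrating in \<open>t\<close> and exchanging the integrals leaves the
  kernel \<open>\<integral> sin (\<pi>t/h) / (z - t) dt\<close>, of modulus at most \<open>h / \<bar>Im z\<bar>\<close>, so the discretization error is
  of order \<open>exp (-\<pi>d/h)\<close>; the vertical sides vanish as the rectangle grows, and the height tends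
  to \<open>d\<close> because the bounds on \<open>f\<close> are only available inside the open strip. The discarded terms of
  the series are of order \<open>exp (-\<pi>dn)\<close>, so crude constants in their estimate are
  absorbed by the gap between \<open>exp (-\<pi>dn)\<close> and \<open>exp (-\<pi>dn / log (4dn/\<mu>))\<close>.
\<close>

section \<open>Elementary inequalities\<close>

text \<open>The constant \<open>C1\<close> dictates how sharp each estimate has to be. Its factor
  \<open>cos (pi/2 * sin d) powr \<nu> * cos d\<close> calls for a lower bound of the modulus of
  \<open>cosh (pi/2 * sinh z)\<close> that separates the height in the strip from the growth along
  it and is an equality at \<open>Re z = 0\<close>; the first inequalities prepare this. The weight
  \<open>cosh s\<close> in the decay bounds is the derivative of \<open>sinh s\<close>, so the
  integrals of the majorants along horizontal lines are explicit. Uniformity in \<tau> comes from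
  the kernel bound, which does not see the end points of integration. When
  \<open>L = ln (4*d*n/\<mu>)\<close> equals \<open>1\<close>, the gap between the two exponentials
  that should absorb the truncation error is closed. The factor
  \<open>exp (pi * (\<alpha> + \<beta>) / 4)\<close> then helps: its part with \<nu> pays for
  replacing \<open>sinh\<close> by an exponential, its part with \<mu> for the numerical constant
  and for the factor \<open>L / (d * n)\<close> demanded by the claim.\<close>

lemma sin_pi_half_ge:
  fixes u :: real
  assumes "0 \<le> u" "u \<le> 1"
  shows "u \<le> sin (pi/2 * u)"
proof -
  have "concave_on {0..1} (\<lambda>u::real. sin (pi/2 * u))"
  proof (rule f''_le0_imp_concave)
    show "\<And>x. x \<in> {0..1} \<Longrightarrow> ((\<lambda>u. sin (pi/2 * u)) has_real_derivative pi/2 * cos (pi/2 * x)) (at x)"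
      by (auto intro!: derivative_eq_intros)
    show "\<And>x. x \<in> {0..1} \<Longrightarrow> ((\<lambda>u. pi/2 * cos (pi/2 * u)) has_real_derivative (- ((pi/2)^2 * sin (pi/2 * x)))) (at x)"
      by (auto intro!: derivative_eq_intros simp: power2_eq_square)
    show "- ((pi/2)^2 * sin (pi/2 * x)) \<le> 0" if "x \<in> {0..1}" for x
    proof -
      have "sin (pi/2 * x) \<ge> 0"
        using that by (intro sin_ge_zero) (auto intro: order_trans[OF mult_left_le])
      thus ?thesis by simp
    qed
  qed auto
  from concave_onD[OF this, of u 0 1] assms show ?thesis by simp
qed

text \<open>The inequality \<open>sin y \<le> y\<close> at the complementary angle
  \<open>y = pi/2 - x\<close>.\<close>

lemma cos_add_le_pi_half:
  fixes x :: real
  assumes "x \<le> pi/2"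
  shows "cos x + x \<le> pi/2"
  using sin_x_le_x[of "pi/2 - x"] assms by (simp add: sin_diff)

lemma le_sinh_real:
  fixes x :: real
  assumes "0 \<le> x"
  shows "x \<le> sinh x"
proof -
  have "sinh 0 - 0 \<le> sinh x - x"
  proof (rule DERIV_nonneg_imp_nondecreasing[OF assms])
    fix t :: real
    show "\<exists>y. ((\<lambda>x. sinh x - x) has_real_derivative y) (at t) \<and> 0 \<le> y"
      by (intro exI[of _ "cosh t - 1"]) (auto intro!: derivative_eq_intros simp: cosh_real_ge_1)
  qed
  thus ?thesis by simp
qed

text \<open>
  For \<open>u cosh s \<le> 1\<close> the difference of the two sides is increasing in \<open>s\<close> and vanishes at \<open>0\<close>;
  beyond that point the right-hand side is at least \<open>1\<close>.
\<close>
lemma abs_sin_mult_cosh_le: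
  fixes u v s :: real
  assumes u: "0 \<le> u" "u \<le> 1" and v: "0 \<le> v" "v^2 = 1 - u^2" and s: "0 \<le> s"
  shows "\<bar>sin (pi/2 * u * cosh s)\<bar> \<le> sin (pi/2 * u) * cosh (pi/2 * v * sinh s)"
proof -
  have sin_pos: "sin (pi/2 * u) \<ge> 0"
    using u sin_pi_half_ge[of u] by linarith
  have small: "sin (pi/2 * u * cosh s) \<le> sin (pi/2 * u) * cosh (pi/2 * v * sinh s)"
    if s: "0 \<le> s" and us: "u * cosh s \<le> 1" for s
  proof -
    define F where "F = (\<lambda>r. sin (pi/2 * u) * cosh (pi/2 * v * sinh r) - sin (pi/2 * u * cosh r))"
    define F' where "F' = (\<lambda>r. sin (pi/2 * u) * (sinh (pi/2 * v * sinh r) * (pi/2 * v * cosh r))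
                              - cos (pi/2 * u * cosh r) * (pi/2 * u * sinh r))"
    have "F 0 \<le> F s"
    proof (rule DERIV_nonneg_imp_nondecreasing[OF s])
      fix r assume r: "0 \<le> r" "r \<le> s"
      have "(F has_real_derivative F' r) (at r)"
        unfolding F_def F'_def by (auto intro!: derivative_eq_intros simp: algebra_simps)
      \<comment> \<open>The factors are compared one by one: the cosine is at most
        \<open>pi/2 * (1 - u) \<le> pi/2 * v^2\<close>, which supplies the two factors
        \<open>v\<close> of the positive term, while \<open>u\<close> is bounded by
        \<open>sin (pi/2 * u)\<close> and the argument of \<open>sinh\<close> by its value.\<close>
      moreover have "F' r \<ge> 0"
      proof -
        have sr: "sinh r \<ge> 0" using r by simp
        have cr: "cosh r \<ge> 1" by (rule cosh_real_ge_1)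
        have "cosh r \<le> cosh s"
          using r s by (subst cosh_real_nonneg_le_iff) auto
        hence ur: "u * cosh r \<le> 1" using us u mult_left_mono[of "cosh r" "cosh s" u] by linarith
        have u_le: "u \<le> u * cosh r" using cr u mult_left_mono[of 1 "cosh r" u] by simp
        have "cos (pi/2 * u * cosh r) \<le> cos (pi/2 * u)"
        proof (rule cos_monotone_0_pi_le)
          show "0 \<le> pi/2 * u" using u by simp
          show "pi/2 * u \<le> pi/2 * u * cosh r" using u_le by (simp add: mult.assoc)
          have "pi/2 * (u * cosh r) \<le> pi/2 * 1" using ur by (intro mult_left_mono) auto
          thus "pi/2 * u * cosh r \<le> pi" using pi_gt_zero by (simp only: mult.assoc)
        qed
        also have "\<dots> \<le> pi/2 * (1 - u)"
        proof -
          have "pi/2 * u \<le> pi/2 * 1" using u by (intro mult_left_mono) auto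
          from cos_add_le_pi_half[of "pi/2 * u"] this show ?thesis by (simp add: algebra_simps)
        qed
        also have "\<dots> \<le> pi/2 * (v^2)"
          using u unfolding v(2) by (intro mult_left_mono) (auto simp: power2_eq_square mult_left_le)
        finally have c: "cos (pi/2 * u * cosh r) \<le> pi/2 * v^2" .
        have "cos (pi/2 * u * cosh r) * (pi/2 * u * sinh r) \<le> pi/2 * v^2 * (pi/2 * u * sinh r)"
          using c u sr by (intro mult_right_mono) auto
        also have "\<dots> = u * ((pi/2 * v * sinh r) * (pi/2 * v * 1))"
          by (simp add: power2_eq_square)
        also have "\<dots> \<le> sin (pi/2 * u) * (sinh (pi/2 * v * sinh r) * (pi/2 * v * cosh r))"
        proof (intro mult_mono)
          show "u \<le> sin (pi/2 * u)" by (rule sin_pi_half_ge[OF u])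
          show "pi/2 * v * sinh r \<le> sinh (pi/2 * v * sinh r)"
            using v sr by (intro le_sinh_real) auto
        qed (use v sr cr sin_pos in auto)
        finally show ?thesis unfolding F'_def by simp
      qed
      ultimately show "\<exists>y. (F has_real_derivative y) (at r) \<and> 0 \<le> y" by blast
    qed
    thus ?thesis by (simp add: F_def)
  qed
  show ?thesis
  proof (cases "u * cosh s \<le> 1")
    case True
    have "sin (pi/2 * u * cosh s) \<ge> 0"
    proof (rule sin_ge_zero)
      show "0 \<le> pi/2 * u * cosh s" using u by simp
      have "pi/2 * (u * cosh s) \<le> pi/2 * 1" using True by (intro mult_left_mono) auto
      thus "pi/2 * u * cosh s \<le> pi" using pi_gt_zero by (simp only: mult.assoc)
    qed
    with small[OF s True] show ?thesis by simp
  next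
    case False
    hence u0: "u > 0" using u by (cases "u = 0") auto
    \<comment> \<open>The point with \<open>u * cosh r = 1\<close>: there the first case has
      \<open>sin (pi/2) = 1\<close> on the left, and from there on the right-hand side only
      grows.\<close>
    define r where "r = \<bar>arcosh (1/u)\<bar>"
    have cr: "cosh r = 1/u" unfolding r_def cosh_real_abs using u u0 by (intro cosh_arcosh_real) auto
    have r0: "r \<ge> 0" by (simp add: r_def)
    have "cosh r < cosh s" unfolding cr using False u0 by (simp add: pos_divide_less_eq mult.commute)
    hence rs: "r \<le> s" using r0 s by (simp add: cosh_real_nonneg_less_iff)
    have "1 \<le> sin (pi/2 * u) * cosh (pi/2 * v * sinh r)"
      using small[OF r0] cr u0 by simp
    also have "\<dots> \<le> sin (pi/2 * u) * cosh (pi/2 * v * sinh s)"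
    proof (intro mult_left_mono sin_pos)
      have "pi/2 * v * sinh r \<le> pi/2 * v * sinh s" using rs v by (intro mult_left_mono) auto
      thus "cosh (pi/2 * v * sinh r) \<le> cosh (pi/2 * v * sinh s)"
        using r0 s v by (subst cosh_real_nonneg_le_iff) auto
    qed
    finally show ?thesis using abs_sin_le_one[of "pi/2 * u * cosh s"] by linarith
  qed
qed

section \<open>Modulus of complex hyperbolic functions\<close>

lemma Re_sinh: "Re (sinh z) = sinh (Re z) * cos (Im z)"
  and Im_sinh: "Im (sinh z) = cosh (Re z) * sin (Im z)"
  and Re_cosh: "Re (cosh z) = cosh (Re z) * cos (Im z)"
  and Im_cosh: "Im (cosh z) = sinh (Re z) * sin (Im z)"
  by (simp_all add: sinh_def cosh_def Re_exp Im_exp algebra_simps)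

lemma norm_cosh_square: "norm (cosh z)^2 = cosh (Re z)^2 - sin (Im z)^2"
proof -
  have "norm (cosh z)^2 = (cosh (Re z) * cos (Im z))^2 + (sinh (Re z) * sin (Im z))^2"
    by (subst cmod_power2) (simp add: Re_cosh Im_cosh)
  also have "\<dots> = cosh (Re z)^2 - sin (Im z)^2"
    by (simp add: power_mult_distrib cos_squared_eq sinh_square_eq) (simp add: algebra_simps)
  finally show ?thesis .
qed

text \<open>By \<open>norm_cosh_square\<close> the claim is a bound on the sine of
  \<open>pi/2 * sin y * cosh s\<close>, namely \<open>abs_sin_mult_cosh_le\<close> with
  \<open>u = sin y\<close> and \<open>v = cos y\<close>. The cosine factor vanishes only at height
  \<open>pi/2\<close>; the other factor carries the double exponential growth.\<close>

lemma norm_cosh_sinh_ge: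
  fixes z :: complex
  assumes "\<bar>Im z\<bar> \<le> pi/2"
  shows "cos (pi/2 * sin (Im z)) * cosh (pi/2 * cos (Im z) * sinh (Re z))
           \<le> norm (cosh (complex_of_real (pi/2) * sinh z))"
proof -
  define y where "y = \<bar>Im z\<bar>"
  define s where "s = \<bar>Re z\<bar>"
  have y: "0 \<le> y" "y \<le> pi/2" using assms by (auto simp: y_def)
  have sy: "sin y \<ge> 0" "cos y \<ge> 0" using y by (auto intro!: sin_ge_zero cos_ge_zero)
  let ?a = "pi/2 * cos y * sinh s" and ?b = "pi/2 * sin y * cosh s"
  have "\<bar>sin ?b\<bar> \<le> sin (pi/2 * sin y) * cosh ?a"
    by (rule abs_sin_mult_cosh_le) (use sy in \<open>auto simp: cos_squared_eq s_def\<close>)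
  hence "sin ?b ^2 \<le> (sin (pi/2 * sin y) * cosh ?a)^2"
    by (metis abs_ge_zero power2_abs power_mono)
  hence *: "(cos (pi/2 * sin y) * cosh ?a)^2 \<le> cosh ?a ^2 - sin ?b^2"
    by (simp add: power_mult_distrib cos_squared_eq left_diff_distrib)
  have "cosh (pi/2 * cos (Im z) * sinh (Re z)) = cosh ?a"
  proof (cases "Re z \<ge> 0")
    case False
    hence "pi/2 * cos y * sinh s = - (pi/2 * cos (Im z) * sinh (Re z))" by (simp add: s_def y_def)
    thus ?thesis by (simp only: cosh_minus)
  qed (simp add: s_def y_def)
  moreover have "cos (pi/2 * sin (Im z)) = cos (pi/2 * sin y)"
    by (cases "Im z \<ge> 0") (auto simp: y_def)
  moreover have "norm (cosh (complex_of_real (pi/2) * sinh z))^2 = cosh ?a ^2 - sin ?b^2"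
  proof -
    have "cosh (pi/2 * (cos (Im z) * sinh (Re z))) = cosh ?a"
      using calculation(1) by (simp add: mult.assoc)
    moreover have "sin (pi/2 * (sin (Im z) * cosh (Re z)))^2 = sin ?b ^2"
      by (cases "Im z \<ge> 0") (auto simp: y_def s_def mult.assoc)
    ultimately show ?thesis
      by (subst norm_cosh_square) (simp add: Re_sinh Im_sinh mult_ac)
  qed
  ultimately have "(cos (pi/2 * sin (Im z)) * cosh (pi/2 * cos (Im z) * sinh (Re z)))^2
       \<le> norm (cosh (complex_of_real (pi/2) * sinh z))^2"
    using * by (simp only:)
  thus ?thesis by (rule power2_le_imp_le) simp
qed

text \<open>Beyond \<open>1\<close> the functions \<open>Si x + (cos x + c) / x\<close> with
  \<open>c = 1\<close> and \<open>c = -1\<close> have the derivative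
  \<open>- (cos x + c) / x^2\<close> of constant sign, which bounds \<open>Si\<close> on both sides
  by values at \<open>1\<close>. Any constant up to \<open>pi\<close> serves the purpose that the
  difference of two values is at most \<open>2 * pi\<close>.\<close>

lemma abs_Si_le_3: "\<bar>Si x\<bar> \<le> 3"
proof -
  have sinc_le: "\<bar>sinc t\<bar> \<le> 1" for t :: real
    using abs_sin_x_le_abs_x[of t] by (auto simp: divide_simps abs_mult)
  have Si0: "Si 0 = 0" by (simp add: Si_def zero_ereal_def)
  have small: "\<bar>Si x\<bar> \<le> x" if "0 \<le> x" for x
  proof -
    have "Si 0 + 0 \<le> Si x + x"
    proof (rule DERIV_nonneg_imp_nondecreasing[of 0 x "\<lambda>x. Si x + x"])
      fix t :: real
      show "\<exists>y. ((\<lambda>x. Si x + x) has_real_derivative y) (at t) \<and> 0 \<le> y"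
        using sinc_le[of t] by (intro exI[of _ "sinc t + 1"] conjI DERIV_add DERIV_Si DERIV_ident) linarith
    qed (use that in auto)
    moreover have "0 - Si 0 \<le> x - Si x"
    proof (rule DERIV_nonneg_imp_nondecreasing[of 0 x "\<lambda>x. x - Si x"])
      fix t :: real
      show "\<exists>y. ((\<lambda>x. x - Si x) has_real_derivative y) (at t) \<and> 0 \<le> y"
        using sinc_le[of t] by (intro exI[of _ "1 - sinc t"] conjI DERIV_diff DERIV_Si DERIV_ident) linarith
    qed (use that in auto)
    ultimately show ?thesis using Si0 by simp
  qed
  have nonneg: "\<bar>Si x\<bar> \<le> 3" if "0 \<le> x" for x
  proof (cases "x \<le> 1")
    case True
    with small[OF that] show ?thesis by simp
  next
    case False
    have deriv: "((\<lambda>x. Si x + (cos x + c) / x) has_real_derivative (- (cos t + c) / t^2)) (at t)"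
      if "t \<ge> 1" for t c :: real
    proof -
      have "((\<lambda>x. Si x + (cos x + c) / x) has_real_derivative
              (sinc t + (- sin t * t - (cos t + c)) / (t * t))) (at t)"
        using that by (intro DERIV_add DERIV_Si) (auto intro!: derivative_eq_intros)
      also have "(sinc t + (- sin t * t - (cos t + c)) / (t * t)) = - (cos t + c) / t^2"
        using that by (simp add: field_simps power2_eq_square)
      finally show ?thesis .
    qed
    have "Si x + (cos x + 1) / x \<le> Si 1 + (cos 1 + 1) / 1"
    proof (rule DERIV_nonpos_imp_nonincreasing[of 1 x "\<lambda>x. Si x + (cos x + 1) / x"])
      fix t :: real assume "1 \<le> t"
      moreover have "- (cos t + 1) / t^2 \<le> 0"
        using cos_ge_minus_one[of t] by (intro divide_nonpos_nonneg) auto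
      ultimately show "\<exists>y. ((\<lambda>x. Si x + (cos x + 1) / x) has_real_derivative y) (at t) \<and> y \<le> 0"
        using deriv[of t 1] by blast
    qed (use False in auto)
    moreover have "(cos x + 1) / x \<ge> 0"
      using cos_ge_minus_one[of x] that by (intro divide_nonneg_nonneg) linarith+
    moreover have "Si 1 + (cos 1 + (- 1)) / 1 \<le> Si x + (cos x + (- 1)) / x"
    proof (rule DERIV_nonneg_imp_nondecreasing[of 1 x "\<lambda>x. Si x + (cos x + (- 1)) / x"])
      fix t :: real assume "1 \<le> t"
      moreover have "- (cos t + (- 1)) / t^2 \<ge> 0"
        using cos_le_one[of t] by (intro divide_nonneg_nonneg) auto
      ultimately show "\<exists>y. ((\<lambda>x. Si x + (cos x + (- 1)) / x) has_real_derivative y) (at t) \<and> 0 \<le> y"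
        using deriv[of t "-1"] by blast
    qed (use False in auto)
    moreover have "(cos x + (- 1)) / x \<le> 0"
      using cos_le_one[of x] that by (intro divide_nonpos_nonneg) linarith+
    ultimately show ?thesis
      using small[of 1] cos_le_one[of 1] cos_ge_minus_one[of 1]
      by (simp only: abs_le_iff div_by_1) linarith
  qed
  show ?thesis
    using nonneg[of x] nonneg[of "- x"] Si_neg[of "- x"] by (cases "x \<ge> 0") auto
qed

section \<open>The sine kernel\<close>

lemma contour_integral_linepath_translate:
  "contour_integral (linepath (a + c) (b + c)) f = contour_integral (linepath a b) (\<lambda>z. f (z + c))"
proof -
  have "linepath (a + c) (b + c) t = linepath a b t + c" for t
    by (simp add: linepath_def algebra_simps)
  thus ?thesis
    by (simp add: contour_integral_integral)
qed

lemma contour_integral_horizontal: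
  assumes "a < b"
  shows "contour_integral (linepath (complex_of_real a + c) (complex_of_real b + c)) f =
           integral {a..b} (\<lambda>s. f (of_real s + c))"
  unfolding contour_integral_linepath_translate
  using assms by (subst contour_integral_linepath_Reals_eq) auto

text \<open>
  Integration by parts; with \<open>\<theta>\<close> the argument under which an end point is seen from \<open>z\<close>, each end
  contributes at most \<open>cos \<theta> + \<theta> \<le> \<pi>/2\<close>, boundary term and half of the integral together.
\<close>
lemma norm_integral_sin_kernel_le:
  fixes z :: complex and a b c :: real
  assumes c: "c > 0" and z: "Im z \<noteq> 0" and ab: "a \<le> b"
  shows "norm (integral {a..b} (\<lambda>t. of_real (sin (c * t)) / (z - of_real t))) \<le> pi / (c * \<bar>Im z\<bar>)"
proof -
  define s where "s = Re z"
  define e where "e = \<bar>Im z\<bar>"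
  have e: "e > 0" using z by (simp add: e_def)
  have ne: "z - of_real t \<noteq> 0" for t using z by (auto simp: complex_eq_iff)
  have norm2: "norm (z - of_real t) ^ 2 = (t - s)^2 + e^2" for t
    by (subst cmod_power2) (simp add: s_def e_def power2_eq_square algebra_simps)
  \<comment> \<open>For \<open>\<theta> = arctan ((t - s) / e)\<close> the reciprocal distance is
    \<open>cos \<theta> / e\<close>, and its square is the derivative of \<theta> divided by
    \<open>e\<close>. Boundary terms and remaining integral thus come on the same scale
    \<open>1 / (c * e)\<close>.\<close>
  have norm1: "1 / norm (z - of_real t) = cos (arctan ((t - s) / e)) / e" for t
  proof -
    have "norm (z - of_real t) = sqrt ((t - s)^2 + e^2)"
      by (subst norm2[symmetric]) simp
    also have "(t - s)^2 + e^2 = (1 + ((t - s) / e)^2) * e^2"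
      using e by (simp add: field_simps)
    also have "sqrt \<dots> = sqrt (1 + ((t - s) / e)^2) * e"
      using e by (simp add: real_sqrt_mult)
    finally show ?thesis by (simp add: cos_arctan)
  qed
  define F where "F = (\<lambda>w. - cos (of_real c * w) / (of_real c * (z - w)))"
  define k where "k = (\<lambda>t. of_real (cos (c * t)) / (of_real c * (z - of_real t)^2))"
  have "((\<lambda>t. of_real (sin (c * t)) / (z - of_real t) - k t) has_integral
            (F (of_real b) - F (of_real a))) {a..b}"
  proof (rule fundamental_theorem_of_calculus[OF ab])
    fix t assume "t \<in> {a..b}"
    have "(F has_field_derivative
            sin (of_real c * of_real t) / (z - of_real t) - cos (of_real c * of_real t) / (of_real c * (z - of_real t)^2))
            (at (of_real t))"
      unfolding F_def using ne[of t] c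
      by (auto intro!: derivative_eq_intros simp: divide_simps) (simp add: power2_eq_square algebra_simps)
    from has_vector_derivative_real_field[OF this]
    show "((\<lambda>t. F (of_real t)) has_vector_derivative
            of_real (sin (c * t)) / (z - of_real t) - k t) (at t within {a..b})"
      by (simp add: k_def sin_of_real[symmetric] cos_of_real[symmetric] del: sin_of_real cos_of_real)
  qed
  moreover have k_int: "k integrable_on {a..b}"
    unfolding k_def using ne c by (intro integrable_continuous_real continuous_intros) auto
  ultimately have "((\<lambda>t. of_real (sin (c * t)) / (z - of_real t)) has_integral
            (F (of_real b) - F (of_real a) + integral {a..b} k)) {a..b}"
    using has_integral_add[OF _ integrable_integral[OF k_int]] by fastforce
  hence "norm (integral {a..b} (\<lambda>t. of_real (sin (c * t)) / (z - of_real t))) =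
           norm (F (of_real b) - F (of_real a) + integral {a..b} k)"
    by (simp add: integral_unique)
  also have "\<dots> \<le> norm (F (of_real b)) + norm (F (of_real a)) + norm (integral {a..b} k)"
    by (metis add_mono_thms_linordered_semiring(3) norm_triangle_ineq norm_triangle_ineq4 order_trans)
  also have "norm (F (of_real t)) \<le> cos (arctan ((t - s) / e)) / (c * e)" for t
  proof -
    have "norm (F (of_real t)) = \<bar>cos (c * t)\<bar> / c * (1 / norm (z - of_real t))"
      using c unfolding F_def
      by (simp add: norm_divide norm_mult of_real_mult[symmetric] cos_of_real del: of_real_mult)
    also have "\<dots> \<le> 1 / c * (1 / norm (z - of_real t))"
      using c by (intro mult_right_mono divide_right_mono) auto
    also have "\<dots> = cos (arctan ((t - s) / e)) / (c * e)"
      unfolding norm1 by simp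
    finally show ?thesis .
  qed
  note this[of b]
  also have "norm (F (of_real a)) \<le> cos (arctan ((a - s) / e)) / (c * e)"
    by fact
  also have "norm (integral {a..b} k) \<le> (arctan ((b - s) / e) - arctan ((a - s) / e)) / (c * e)"
  proof -
    have "((\<lambda>t. 1 / (c * ((t - s)^2 + e^2))) has_integral
             (arctan ((b - s) / e) / (c * e) - arctan ((a - s) / e) / (c * e))) {a..b}"
    proof (rule fundamental_theorem_of_calculus[OF ab])
      fix t assume "t \<in> {a..b}"
      have "((\<lambda>t. arctan ((t - s) / e) / (c * e)) has_real_derivative
              inverse (1 + ((t - s) / e)^2) * (1 / e) / (c * e)) (at t)"
        using e c by (auto intro!: derivative_eq_intros)
      also have "inverse (1 + ((t - s) / e)^2) * (1 / e) / (c * e) = 1 / (c * (((t - s)/e)^2 * e^2 + e^2))"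
        using e c by (simp add: divide_simps) (simp add: algebra_simps power2_eq_square)
      also have "((t - s)/e)^2 * e^2 = (t - s)^2" using e by (simp add: power_divide)
      finally show "((\<lambda>t. arctan ((t - s) / e) / (c * e)) has_vector_derivative
              1 / (c * ((t - s)^2 + e^2))) (at t within {a..b})"
        by (simp add: has_real_derivative_iff_has_vector_derivative[symmetric] has_field_derivative_at_within)
    qed
    moreover have "norm (k t) \<le> 1 / (c * ((t - s)^2 + e^2))" for t
    proof -
      have "norm (k t) = \<bar>cos (c * t)\<bar> / (c * ((t - s)^2 + e^2))"
        using c by (simp add: k_def norm_divide norm_mult norm_power norm2)
      also have "\<dots> \<le> 1 / (c * ((t - s)^2 + e^2))"
        using c by (intro divide_right_mono) auto
      finally show ?thesis .
    qed
    ultimately show ?thesis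
      using integral_norm_bound_integral[OF k_int, of "\<lambda>t. 1 / (c * ((t - s)^2 + e^2))"]
      by (auto simp: has_integral_iff diff_divide_distrib)
  qed
  also have "cos (arctan ((b - s) / e)) / (c * e) + cos (arctan ((a - s) / e)) / (c * e)
        + (arctan ((b - s) / e) - arctan ((a - s) / e)) / (c * e)
       = ((cos (arctan ((b - s) / e)) + arctan ((b - s) / e))
          + (cos (- arctan ((a - s) / e)) + (- arctan ((a - s) / e)))) / (c * e)"
    by (simp add: add_divide_distrib diff_divide_distrib)
  also have "\<dots> \<le> (pi/2 + pi/2) / (c * e)"
    using arctan_bounded[of "(b - s) / e"] arctan_bounded[of "(a - s) / e"] c e
    by (intro divide_right_mono add_mono cos_add_le_pi_half) auto
  finally show ?thesis by (simp add: e_def)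
qed

section \<open>Lower bounds for the sine on horizontal and vertical lines\<close>

lemma norm_sin_square: "norm (sin z)^2 = sin (Re z)^2 + sinh (Im z)^2" for z :: complex
proof -
  have "norm (sin z)^2 = (sin (Re z) * cosh (Im z))^2 + (cos (Re z) * sinh (Im z))^2"
    by (subst cmod_power2) (simp add: Re_sin Im_sin cosh_def sinh_def field_simps)
  also have "\<dots> = sin (Re z)^2 + sinh (Im z)^2"
    by (simp add: power_mult_distrib cos_squared_eq cosh_square_eq) (simp add: algebra_simps)
  finally show ?thesis .
qed

lemma norm_sin_ge_sinh: "sinh \<bar>Im z\<bar> \<le> norm (sin z)" for z :: complex
  by (rule power2_le_imp_le) (auto simp: norm_sin_square sinh_real_abs)

lemma norm_sin_ge_abs_sin: "\<bar>sin (Re z)\<bar> \<le> norm (sin z)" for z :: complex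
  by (rule power2_le_imp_le) (auto simp: norm_sin_square)

section \<open>Cardinal series on a rectangle\<close>

lemma sin_scaled_eq_0_iff:
  fixes h :: real and z :: complex
  assumes "h > 0"
  shows "sin (of_real (pi/h) * z) = 0 \<longleftrightarrow> (\<exists>k::int. z = of_real (of_int k * h))"
proof -
  have "sin (of_real (pi/h) * z) = 0 \<longleftrightarrow> (\<exists>k::int. of_real (pi/h) * z = of_real (of_int k * pi))"
    using sin_eq_0 by (simp add: mult.commute)
  also have "\<dots> \<longleftrightarrow> (\<exists>k::int. z = of_real (of_int k * h))"
    using assms by (intro ex_cong1) (auto simp: field_simps)
  finally show ?thesis .
qed

text \<open>The factor \<open>sin (pi/h * t)\<close> in front turns the residue at \<open>t\<close>
  into \<open>g t\<close> and the residues at the nodes into cardinal functions. Excluding nodes as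
  values of \<open>t\<close> makes all poles simple. The half-integer in \<open>R\<close> puts
  exactly the nodes from \<open>-m\<close> to \<open>m\<close> inside the rectangle and none on its
  boundary.\<close>

lemma sinc_residue_formula:
  fixes g :: "complex \<Rightarrow> complex" and h e D t :: real and m :: nat
  assumes hol: "g holomorphic_on {z. \<bar>Im z\<bar> < D}" and e: "0 < e" "e < D" and h: "h > 0"
    and R: "R = (real m + 1/2) * h"
    and t: "\<bar>t\<bar> < R" "\<And>k::int. t \<noteq> of_int k * h"
  shows "of_real (sin (pi/h * t)) * contour_integral (rectpath (Complex (-R) (-e)) (Complex R e))
            (\<lambda>z. g z / ((z - of_real t) * sin (of_real (pi/h) * z)))
         = 2 * pi * \<i> * (g (of_real t) - (\<Sum>k = - int m..int m. g (of_real (of_int k * h)) *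
              of_real (sinc (pi * (t/h - of_int k)))))"
    (is "_ * contour_integral ?p ?F = _")
proof -
  \<comment> \<open>An open convex neighbourhood of the closed rectangle that ends at the next
    nodes, of index \<open>m + 1\<close> and \<open>-(m + 1)\<close>, so that the sine has no zeros
    in it besides \<open>P\<close>.\<close>
  define S where "S = {z. \<bar>Im z\<bar> < D \<and> \<bar>Re z\<bar> < (real m + 1) * h}"
  define P where "P = (\<lambda>k::int. complex_of_real (of_int k * h)) ` {- int m..int m}"
  have S_eq: "S = {z. Im z < D} \<inter> {z. Im z > - D} \<inter> {z. Re z < (real m + 1) * h} \<inter> {z. Re z > - ((real m + 1) * h)}"
    by (auto simp: S_def abs_less_iff)
  have S: "open S" "convex S"
    unfolding S_eq
    by (intro open_Int open_halfspace_Im_lt open_halfspace_Im_gt open_halfspace_Re_lt open_halfspace_Re_gt)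
       (intro convex_Int convex_halfspace_Im_lt convex_halfspace_Im_gt convex_halfspace_Re_lt convex_halfspace_Re_gt)
  have R0: "0 < R" "R < (real m + 1) * h" using h by (auto simp: R field_simps intro: add_pos_nonneg)
  have g_S: "g holomorphic_on A" if "A \<subseteq> S" for A
    using hol by (rule holomorphic_on_subset) (use that in \<open>auto simp: S_def\<close>)
  have sin_nz: "sin (of_real (pi/h) * z) \<noteq> 0" if "z \<in> S - P" for z
  proof
    assume "sin (of_real (pi/h) * z) = 0"
    then obtain k :: int where k: "z = of_real (of_int k * h)" using sin_scaled_eq_0_iff[OF h] by blast
    have "\<bar>of_int k * h\<bar> < (real m + 1) * h" using that k by (auto simp: S_def)
    hence "\<bar>real_of_int k\<bar> < real m + 1" using h by (simp add: abs_mult)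
    hence "\<bar>k\<bar> < int m + 1" by linarith
    hence "k \<in> {- int m..int m}" by auto
    thus False using that k by (auto simp: P_def)
  qed
  have tP: "complex_of_real t \<notin> P" using t(2) by (auto simp: P_def simp del: of_real_mult)
  have tS: "complex_of_real t \<in> S" using t(1) R0 e by (auto simp: S_def)
  have P_box: "P \<subseteq> box (Complex (-R) (-e)) (Complex R e)"
  proof
    fix z assume "z \<in> P"
    then obtain k :: int where k: "z = of_real (of_int k * h)" "k \<in> {- int m..int m}"
      unfolding P_def by blast
    have "\<bar>of_int k * h\<bar> < R"
    proof -
      have "\<bar>real_of_int k\<bar> \<le> real m" using k(2) by auto
      hence "\<bar>real_of_int k\<bar> < real m + 1/2" by linarith
      thus ?thesis using h by (simp add: R abs_mult)
    qed
    thus "z \<in> box (Complex (-R) (-e)) (Complex R e)"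
      using e k(1) by (auto simp: in_box_complex_iff abs_less_iff)
  qed
  have t_box: "complex_of_real t \<in> box (Complex (-R) (-e)) (Complex R e)"
    using t(1) e by (auto simp: in_box_complex_iff)
  have cbox_S: "cbox (Complex (-R) (-e)) (Complex R e) \<subseteq> S"
    using R0 e by (auto simp: in_cbox_complex_iff S_def)
  have box_S: "box (Complex (-R) (-e)) (Complex R e) \<subseteq> S"
    using cbox_S box_subset_cbox by blast
  have path_S: "path_image ?p \<subseteq> S"
    using path_image_rectpath_subset_cbox[of "Complex (-R) (-e)" "Complex R e"] R0 e cbox_S by auto
  have path_P: "path_image ?p \<inter> box (Complex (-R) (-e)) (Complex R e) = {}"
    using path_image_rectpath_inter_box[of "Complex (-R) (-e)" "Complex R e"] R0 e by auto
  have residue_node: "residue ?F (of_real (of_int k * h)) =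
       g (of_real (of_int k * h)) / (of_real ((of_int k * h - t) * (pi/h * cos (pi * of_int k))))"
    if k: "k \<in> {- int m..int m}" for k
  proof (rule residue_simple'[where s = "S - (P - {of_real (of_int k * h)}) - {of_real t}"])
    let ?z = "complex_of_real (of_int k * h)"
    have kP: "?z \<in> P" using k by (auto simp: P_def)
    show "open (S - (P - {?z}) - {of_real t})"
      using S(1) by (intro open_Diff finite_imp_closed) (auto simp: P_def)
    show "?z \<in> S - (P - {?z}) - {of_real t}"
      using kP P_box box_S tP by auto
    show "?F holomorphic_on S - (P - {?z}) - {of_real t} - {?z}"
      using sin_nz by (intro holomorphic_intros g_S) auto
    \<comment> \<open>The residue is the limit of \<open>?F w * (w - ?z)\<close>, and the sine
      divided by \<open>w - ?z\<close> tends to its derivative at the node.\<close>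
    have "((\<lambda>w. sin (of_real (pi/h) * w)) has_field_derivative (of_real (pi/h) * cos (of_real (pi/h) * ?z))) (at ?z)"
      by (auto intro!: derivative_eq_intros)
    moreover have "sin (of_real (pi/h) * ?z) = 0"
      using sin_scaled_eq_0_iff[OF h] by blast
    ultimately have "((\<lambda>w. sin (of_real (pi/h) * w) / (w - ?z)) \<longlongrightarrow> of_real (pi/h) * cos (of_real (pi/h) * ?z)) (at ?z)"
      unfolding has_field_derivative_iff by simp
    moreover have "of_real (pi/h) * cos (of_real (pi/h) * ?z) = complex_of_real (pi/h * cos (pi * of_int k))"
    proof -
      have "of_real (pi/h) * ?z = complex_of_real (pi * of_int k)" using h by simp
      hence "cos (of_real (pi/h) * ?z) = of_real (cos (pi * of_int k))" by (simp only: cos_of_real)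
      thus ?thesis unfolding of_real_mult[of "pi/h" "cos (pi * of_int k)"] by (simp only:)
    qed
    ultimately have lim1: "((\<lambda>w. sin (of_real (pi/h) * w) / (w - ?z)) \<longlongrightarrow> complex_of_real (pi/h * cos (pi * of_int k))) (at ?z)"
      by (simp only:)
    have nz: "complex_of_real (pi/h * cos (pi * of_int k)) \<noteq> 0"
      using h cos_int_times_real[of k] by (auto simp: mult.commute)
    have gc: "isCont g ?z"
    proof -
      have "continuous_on S g" using g_S[of S] holomorphic_on_imp_continuous_on by blast
      thus ?thesis using S(1) kP P_box box_S continuous_on_eq_continuous_at by blast
    qed
    have "((\<lambda>w. g w / (w - of_real t) / (sin (of_real (pi/h) * w) / (w - ?z))) \<longlongrightarrow>
             g ?z / (?z - of_real t) / complex_of_real (pi/h * cos (pi * of_int k))) (at ?z)"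
      using gc kP tP nz by (intro tendsto_intros lim1 isContD) auto
    also have "(\<lambda>w. g w / (w - of_real t) / (sin (of_real (pi/h) * w) / (w - ?z))) = (\<lambda>w. ?F w * (w - ?z))"
      by (simp add: field_simps)
    finally show "((\<lambda>w. ?F w * (w - ?z)) \<longlongrightarrow> g ?z / (of_real ((of_int k * h - t) * (pi/h * cos (pi * of_int k))))) (at ?z)"
      by (simp only: of_real_mult of_real_diff divide_divide_eq_left)
  qed
  have "contour_integral ?p ?F =
          2 * pi * \<i> * (\<Sum>p\<in>insert (of_real t) P. winding_number ?p p * residue ?F p)"
  proof (rule Residue_theorem[where S = S])
    show "finite (insert (complex_of_real t) P)" by (simp add: P_def)
    show "?F holomorphic_on S - insert (complex_of_real t) P"
      using sin_nz by (intro holomorphic_intros g_S) auto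
    show "path_image ?p \<subseteq> S - insert (complex_of_real t) P"
      using path_S path_P P_box t_box by blast
    show "\<forall>z. z \<notin> S \<longrightarrow> winding_number ?p z = 0"
    proof (intro allI impI)
      fix z assume "z \<notin> S"
      thus "winding_number ?p z = 0"
        using S path_S by (intro winding_number_zero_outside[of _ S]) auto
    qed
  qed (use S in \<open>auto simp: convex_connected\<close>)
  also have "(\<Sum>p\<in>insert (of_real t) P. winding_number ?p p * residue ?F p)
             = (\<Sum>p\<in>insert (of_real t) P. residue ?F p)"
    using P_box t_box by (intro sum.cong refl) (auto simp: winding_number_rectpath subset_iff)
  also have "\<dots> = residue ?F (of_real t) + (\<Sum>p\<in>P. residue ?F p)"
    using tP by (subst sum.insert) (auto simp: P_def)
  also have "(\<Sum>p\<in>P. residue ?F p) = (\<Sum>k = - int m..int m. residue ?F (of_real (of_int k * h)))"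
    unfolding P_def using h by (subst sum.reindex) (auto simp: inj_on_def)
  also have "residue ?F (of_real t) = g (of_real t) / sin (of_real (pi/h) * of_real t)"
  proof -
    have "residue (\<lambda>w. (g w / sin (of_real (pi/h) * w)) / (w - of_real t)) (of_real t) =
            g (of_real t) / sin (of_real (pi/h) * of_real t)"
    proof (rule residue_simple[where s = "S - P"])
      show "open (S - P)" using S(1) by (intro open_Diff finite_imp_closed) (auto simp: P_def)
      show "(\<lambda>w. g w / sin (of_real (pi/h) * w)) holomorphic_on S - P"
        using sin_nz by (intro holomorphic_intros g_S) auto
    qed (use tS tP in auto)
    thus ?thesis by (simp add: mult.commute)
  qed
  also have "(\<Sum>k = - int m..int m. residue ?F (of_real (of_int k * h))) =
      (\<Sum>k = - int m..int m. g (of_real (of_int k * h)) / (of_real ((of_int k * h - t) * (pi/h * cos (pi * of_int k)))))"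
    by (intro sum.cong refl residue_node)
  also have "sin (of_real (pi/h) * of_real t) = complex_of_real (sin (pi/h * t))"
    by (simp only: sin_of_real of_real_mult[symmetric])
  finally have *: "contour_integral ?p ?F = 2 * pi * \<i> * (g (of_real t) / of_real (sin (pi/h * t)) +
      (\<Sum>k = - int m..int m. g (of_real (of_int k * h)) / (of_real ((of_int k * h - t) * (pi/h * cos (pi * of_int k))))))"
    .
  have sin_t: "sin (pi/h * t) \<noteq> 0"
  proof
    assume "sin (pi/h * t) = 0"
    hence "sin (of_real (pi/h) * complex_of_real t) = 0"
      by (metis of_real_0 of_real_mult sin_of_real)
    then obtain k :: int where "complex_of_real t = of_real (of_int k * h)"
      using sin_scaled_eq_0_iff[OF h] by blast
    thus False using t(2) of_real_eq_iff by blast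
  qed
  have scale: "complex_of_real a * (w / of_real b) = - (w * of_real c)" if "a / b = - c" for a b c w
  proof -
    have "complex_of_real a * (w / of_real b) = w * of_real (a / b)" by simp
    thus ?thesis unfolding that by simp
  qed
  \<comment> \<open>The factor \<open>cos (pi * k)\<close> may change between numerator and
    denominator because its square is \<open>1\<close>; the minus sign comes from
    \<open>k * h - t\<close> against \<open>t - k * h\<close>.\<close>
  have term_eq: "of_real (sin (pi/h * t)) * (g z / (of_real ((of_int k * h - t) * (pi/h * cos (pi * of_int k)))))
      = - (g z * of_real (sinc (pi * (t/h - of_int k))))"
    for z and k :: int
  proof -
    have "t/h - of_int k \<noteq> 0" using t(2)[of k] h by (auto simp: field_simps)
    hence nz: "pi * (t/h - of_int k) \<noteq> 0" by simp
    have c2: "cos (pi * of_int k) * cos (pi * of_int k) = 1"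
      using cos_int_times_real[of k] by (auto simp: mult.commute)
    hence c0: "cos (pi * of_int k) \<noteq> 0" by auto
    have "sin (pi * (t/h - of_int k)) = sin (pi/h * t) * cos (pi * of_int k)"
      using sin_int_times_real[of k] by (simp add: right_diff_distrib sin_diff mult.commute)
    moreover have "sin (pi/h * t) / ((of_int k * h - t) * (pi/h * cos (pi * of_int k))) =
       - (sin (pi/h * t) * cos (pi * of_int k) / (pi * (t/h - of_int k)))"
    proof -
      have "(of_int k * h - t) * (pi/h * cos (pi * of_int k)) = - (pi * (t/h - of_int k)) * cos (pi * of_int k)"
        using h by (simp add: field_simps)
      moreover have "x / (- y * cos (pi * of_int k)) = - (x * cos (pi * of_int k) / y)" if "y \<noteq> 0" for x y
        using that c0 c2 by (simp add: field_simps)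
      ultimately show ?thesis using nz by simp
    qed
    ultimately have "sin (pi/h * t) / ((of_int k * h - t) * (pi/h * cos (pi * of_int k))) =
       - (sinc (pi * (t/h - of_int k)))"
      using nz by simp
    thus ?thesis by (rule scale)
  qed
  have "of_real (sin (pi/h * t)) * contour_integral ?p ?F =
     2 * pi * \<i> * (of_real (sin (pi/h * t)) * (g (of_real t) / of_real (sin (pi/h * t))) +
      (\<Sum>k = - int m..int m. of_real (sin (pi/h * t)) * (g (of_real (of_int k * h)) / (of_real ((of_int k * h - t) * (pi/h * cos (pi * of_int k)))))))"
    unfolding * sum_distrib_left[symmetric] distrib_left[of "of_real (sin (pi/h * t))", symmetric]
    by (rule mult.left_commute)
  also have "of_real (sin (pi/h * t)) * (g (of_real t) / of_real (sin (pi/h * t))) = g (of_real t)"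
    using sin_t by simp
  finally show ?thesis unfolding term_eq sum_negf by (simp only: diff_conv_add_uminus)
qed

text \<open>As the segment keeps away from the interval, the integrand is jointly continuous on a
  compact rectangle of parameters, so the integrals commute. The \<open>has_integral\<close> form
  lets the four sides be added without separate integrability arguments.\<close>

lemma has_integral_contour_linepath_swap:
  fixes G :: "complex \<Rightarrow> complex" and \<phi> :: "real \<Rightarrow> complex" and a b :: real and p q :: complex
  assumes G: "continuous_on (closed_segment p q) G" and \<phi>: "continuous_on {a..b} \<phi>"
    and disj: "\<And>t. t \<in> {a..b} \<Longrightarrow> of_real t \<notin> closed_segment p q"
  shows "((\<lambda>t. \<phi> t * contour_integral (linepath p q) (\<lambda>z. G z / (z - of_real t))) has_integral
            contour_integral (linepath p q) (\<lambda>z. G z * integral {a..b} (\<lambda>t. \<phi> t / (z - of_real t)))) {a..b}"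
proof -
  define k where "k = (\<lambda>t u. \<phi> t * (G (linepath p q u) / (linepath p q u - of_real t) * (q - p)))"
  have seg: "linepath p q u \<in> closed_segment p q" if "u \<in> {0..1}" for u
    using that linepath_in_path by blast
  have lin: "continuous_on A (linepath p q)" for A
    by (rule continuous_on_linepath)
  have Gl: "continuous_on {0..1} (\<lambda>u. G (linepath p q u))"
    by (rule continuous_on_compose2[OF G lin]) (use seg in auto)
  have k_cont: "continuous_on ({a..b} \<times> {0..1}) (\<lambda>(t, u). k t u)"
  proof -
    let ?X = "{a..b} \<times> {0..1::real}"
    have c1: "continuous_on ?X (\<lambda>w. \<phi> (fst w))"
      by (rule continuous_on_compose2[OF \<phi> continuous_on_fst[OF continuous_on_id]]) auto
    have c2: "continuous_on ?X (\<lambda>w. G (linepath p q (snd w)))"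
      by (rule continuous_on_compose2[OF Gl continuous_on_snd[OF continuous_on_id]]) auto
    have c3: "continuous_on ?X (\<lambda>w. linepath p q (snd w))"
      by (rule continuous_on_compose2[OF lin[of "{0..1}"] continuous_on_snd[OF continuous_on_id]]) auto
    have nz: "linepath p q (snd w) - of_real (fst w) \<noteq> 0" if "w \<in> ?X" for w
      using disj[of "fst w"] seg[of "snd w"] that by auto
    show ?thesis unfolding k_def split_def
      using nz by (intro continuous_intros c1 c2 c3) auto
  qed
  have eq: "\<phi> t * contour_integral (linepath p q) (\<lambda>z. G z / (z - of_real t)) = integral {0..1} (k t)" for t
    unfolding k_def by (subst integral_mult_right) (simp add: contour_integral_integral)
  have "continuous_on {a..b} (\<lambda>t. integral (cbox 0 1) (k t))"
    by (rule integral_continuous_on_param) (use k_cont in simp)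
  hence "(\<lambda>t. integral {0..1} (k t)) integrable_on {a..b}"
    by (intro integrable_continuous_real) simp
  moreover have "integral {a..b} (\<lambda>t. integral {0..1} (k t)) = integral {0..1} (\<lambda>u. integral {a..b} (\<lambda>t. k t u))"
    using integral_swap_continuous[of a 0 b 1 k] k_cont by (simp add: cbox_Pair_eq)
  moreover have "integral {a..b} (\<lambda>t. k t u) =
     G (linepath p q u) * integral {a..b} (\<lambda>t. \<phi> t / (linepath p q u - of_real t)) * (q - p)" for u
  proof -
    have "(\<lambda>t. k t u) = (\<lambda>t. (G (linepath p q u) * (q - p)) * (\<phi> t / (linepath p q u - of_real t)))"
      by (simp add: k_def fun_eq_iff)
    thus ?thesis by (simp only: integral_mult_right mult_ac)
  qed
  ultimately show ?thesis
    unfolding eq by (simp add: has_integral_iff contour_integral_integral)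
qed

text \<open>The weight \<open>u\<close> allows an integrated bound; a supremum times the length
  would grow with the rectangle.\<close>

lemma norm_contour_integral_horizontal_le:
  assumes "a < b" and bound: "\<And>s. s \<in> {a..b} \<Longrightarrow> norm (f (of_real s + c)) \<le> B * u s"
    and u: "u integrable_on {a..b}" "integral {a..b} u \<le> A" and B: "0 \<le> B" and A: "0 \<le> A"
  shows "norm (contour_integral (linepath (complex_of_real a + c) (complex_of_real b + c)) f) \<le> B * A"
proof (cases "(\<lambda>s. f (of_real s + c)) integrable_on {a..b}")
  case True
  have "norm (integral {a..b} (\<lambda>s. f (of_real s + c))) \<le> integral {a..b} (\<lambda>s. B * u s)"
    using bound u(1) by (intro integral_norm_bound_integral True integrable_on_mult_right) auto
  also have "\<dots> \<le> B * A" using u B by (simp add: mult_left_mono)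
  finally show ?thesis using assms(1) by (simp add: contour_integral_horizontal)
next
  \<comment> \<open>A non-integrable function has integral \<open>0\<close> by convention.\<close>
  case False
  thus ?thesis using assms(1) A B
    by (simp add: contour_integral_horizontal not_integrable_integral)
qed

lemma norm_contour_integral_linepath_le:
  assumes "0 \<le> B" "\<And>z. z \<in> closed_segment p q \<Longrightarrow> norm (f z) \<le> B"
  shows "norm (contour_integral (linepath p q) f) \<le> B * norm (q - p)"
  using contour_integral_bound_linepath[of f p q B] assms
  by (cases "f contour_integrable_on linepath p q") (auto simp: not_integrable_contour_integral)

text \<open>On the horizontal sides the sine contributes \<open>1 / sinh (pi * e / h)\<close>, the
  kernel \<open>h / e\<close>, and only the mass of \<open>g\<close> enters. On the vertical sides
  the trivial kernel bound \<open>(x - a) / (R - r)\<close> is enough because it vanishes as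
  \<open>R\<close> grows.\<close>

lemma sinc_indefinite_rectangle_bound:
  fixes g :: "complex \<Rightarrow> complex" and h e D a x A\<^sub>1 A\<^sub>2 V r :: real and m :: nat
  assumes hol: "g holomorphic_on {z. \<bar>Im z\<bar> < D}" and e: "0 < e" "e < D" and h: "h > 0"
    and R: "R = (real m + 1/2) * h" and ax: "a < x" and r: "\<bar>a\<bar> \<le> r" "\<bar>x\<bar> \<le> r" "r < R"
    and A1: "integral {-R..R} (\<lambda>s. norm (g (of_real s + \<i> * of_real e))) \<le> A\<^sub>1"
    and A2: "integral {-R..R} (\<lambda>s. norm (g (of_real s + \<i> * of_real (-e)))) \<le> A\<^sub>2"
    and V: "\<And>z. \<bar>Re z\<bar> = R \<Longrightarrow> \<bar>Im z\<bar> \<le> e \<Longrightarrow> norm (g z) \<le> V"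
  shows "norm (integral {a..x} (\<lambda>t. g (of_real t)) - (\<Sum>k = - int m..int m. g (of_real (of_int k * h)) *
            of_real (integral {a..x} (\<lambda>t. sinc (pi * (t/h - of_int k))))))
         \<le> ((A\<^sub>1 + A\<^sub>2) * (h / e) / sinh (pi * e / h) + 4 * e * V * (x - a) / (R - r)) / (2 * pi)"
proof -
  let ?c = "pi/h"
  have c: "?c > 0" using h by simp
  have R0: "R > 0" using h by (auto simp: R intro: add_nonneg_pos)
  define G where "G = (\<lambda>z. g z / sin (of_real ?c * z))"
  define I where "I = (\<lambda>z. integral {a..x} (\<lambda>t. complex_of_real (sin (?c * t)) / (z - of_real t)))"
  define p1 where "p1 = Complex (-R) (-e)"
  define p2 where "p2 = Complex R (-e)"
  define p3 where "p3 = Complex R e"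
  define p4 where "p4 = Complex (-R) e"
  define C where "C = (\<lambda>p q t. contour_integral (linepath p q) (\<lambda>z. G z / (z - of_real t)))"
  define T where "T = (\<lambda>p q. contour_integral (linepath p q) (\<lambda>z. G z * I z))"
  define E where "E = closed_segment p1 p2 \<union> closed_segment p2 p3 \<union> closed_segment p3 p4 \<union> closed_segment p4 p1"
  have sinR: "\<bar>sin (?c * y)\<bar> = 1" if "\<bar>y\<bar> = R" for y
  proof -
    have "?c * R = real m * pi + pi/2" using h by (simp add: R field_simps)
    hence "sin (?c * R) = cos (real m * pi)" by (simp add: sin_add)
    hence "\<bar>sin (?c * R)\<bar> = 1" by (simp add: cos_npi)
    moreover have "y = R \<or> y = - R" using that by auto
    ultimately show ?thesis by auto
  qed
  have E: "(\<bar>Re z\<bar> = R \<and> \<bar>Im z\<bar> \<le> e) \<or> (\<bar>Im z\<bar> = e \<and> \<bar>Re z\<bar> \<le> R)" if "z \<in> E" for z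
    using that R0 e unfolding E_def p1_def p2_def p3_def p4_def
    by (auto simp: closed_segment_same_Re closed_segment_same_Im closed_segment_eq_real_ivl)
  have sin_nz: "sin (of_real ?c * z) \<noteq> 0" if "z \<in> E" for z
    using E[OF that]
  proof
    assume "\<bar>Re z\<bar> = R \<and> \<bar>Im z\<bar> \<le> e"
    thus ?thesis using sinR[of "Re z"] norm_sin_ge_abs_sin[of "of_real ?c * z"] by auto
  next
    assume "\<bar>Im z\<bar> = e \<and> \<bar>Re z\<bar> \<le> R"
    hence "Im (of_real ?c * z) \<noteq> 0" using c e by auto
    thus ?thesis using norm_sin_ge_sinh[of "of_real ?c * z"] by auto
  qed
  have G_cont: "continuous_on E G"
  proof -
    have "continuous_on E g"
      by (rule continuous_on_subset[OF holomorphic_on_imp_continuous_on[OF hol]]) (use E e in force)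
    thus ?thesis unfolding G_def using sin_nz by (intro continuous_intros) auto
  qed
  have t_notin: "of_real t \<notin> E" if "t \<in> {a..x}" for t
    using E[of "of_real t"] that r e by auto
  have swap: "((\<lambda>t. of_real (sin (?c * t)) * C p q t) has_integral T p q) {a..x}"
    if "closed_segment p q \<subseteq> E" for p q
    unfolding C_def T_def I_def
    by (intro has_integral_contour_linepath_swap continuous_on_subset[OF G_cont that] continuous_intros)
       (use t_notin that in blast)
  have sides: "closed_segment p1 p2 \<subseteq> E" "closed_segment p2 p3 \<subseteq> E"
    "closed_segment p3 p4 \<subseteq> E" "closed_segment p4 p1 \<subseteq> E"
    by (auto simp: E_def)
  have rect: "rectpath (Complex (-R) (-e)) (Complex R e) =
      linepath p1 p2 +++ linepath p2 p3 +++ linepath p3 p4 +++ linepath p4 p1"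
    by (simp add: rectpath_def Let_def p1_def p2_def p3_def p4_def)
  have total: "((\<lambda>t. of_real (sin (?c * t)) * C p1 p2 t + of_real (sin (?c * t)) * C p2 p3 t
           + of_real (sin (?c * t)) * C p3 p4 t + of_real (sin (?c * t)) * C p4 p1 t)
        has_integral (T p1 p2 + T p2 p3 + T p3 p4 + T p4 p1)) {a..x}"
    by (intro has_integral_add swap sides)
  define W where "W = (\<lambda>t. g (of_real t) - (\<Sum>k = - int m..int m. g (of_real (of_int k * h)) *
              of_real (sinc (pi * (t/h - of_int k)))))"
  have "((\<lambda>t. 2 * pi * \<i> * W t) has_integral (T p1 p2 + T p2 p3 + T p3 p4 + T p4 p1)) {a..x}"
  proof (rule has_integral_spike_finite[OF _ _ total])
    let ?N = "(\<lambda>k::int. of_int k * h) ` {- int m..int m}"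
    show "finite ?N" by simp
    fix t assume t: "t \<in> {a..x} - ?N"
    have tR: "\<bar>t\<bar> < R" using t r by auto
    have tk: "t \<noteq> of_int k * h" for k :: int
    proof
      assume tk: "t = of_int k * h"
      hence "\<bar>real_of_int k\<bar> < real m + 1/2" using tR h by (simp add: R abs_mult)
      hence "\<bar>k\<bar> \<le> int m" by linarith
      hence "k \<in> {- int m..int m}" by auto
      thus False using t tk by auto
    qed
    define Fn where "Fn = (\<lambda>z. g z / ((z - of_real t) * sin (of_real ?c * z)))"
    have ctg: "Fn contour_integrable_on linepath p q"
      if "closed_segment p q \<subseteq> E" for p q
    proof -
      have "continuous_on (closed_segment p q) (\<lambda>z. G z / (z - of_real t))"
        using t_notin[of t] t that by (intro continuous_intros continuous_on_subset[OF G_cont that]) auto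
      also have "(\<lambda>z. G z / (z - of_real t)) = Fn"
        by (simp add: Fn_def G_def fun_eq_iff mult.commute)
      finally show ?thesis by (rule contour_integrable_continuous_linepath)
    qed
    have C_eq: "contour_integral (linepath p q) Fn = C p q t" for p q
      by (simp add: C_def Fn_def G_def mult.commute)
    have "contour_integral (rectpath (Complex (-R) (-e)) (Complex R e)) Fn
            = C p1 p2 t + (C p2 p3 t + (C p3 p4 t + C p4 p1 t))"
      unfolding rect
      by (simp add: contour_integral_join contour_integrable_joinI ctg sides C_eq)
    thus "2 * pi * \<i> * W t = of_real (sin (?c * t)) * C p1 p2 t + of_real (sin (?c * t)) * C p2 p3 t
           + of_real (sin (?c * t)) * C p3 p4 t + of_real (sin (?c * t)) * C p4 p1 t"
      using sinc_residue_formula[OF hol e h R tR tk] unfolding Fn_def[symmetric] W_def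
      by (simp add: algebra_simps)
  qed
  from integral_unique[OF this]
  have "2 * pi * \<i> * integral {a..x} W = T p1 p2 + T p2 p3 + T p3 p4 + T p4 p1" by simp
  hence "norm (2 * pi * \<i> * integral {a..x} W) = norm (T p1 p2 + T p2 p3 + T p3 p4 + T p4 p1)" by simp
  hence "2 * pi * norm (integral {a..x} W) = norm (T p1 p2 + T p2 p3 + T p3 p4 + T p4 p1)"
    by (simp add: norm_mult)
  also have "\<dots> \<le> norm (T p1 p2) + norm (T p2 p3) + norm (T p3 p4) + norm (T p4 p1)"
    by (intro order_trans[OF norm_triangle_ineq] add_mono order_refl)
  also have "\<dots> \<le> (h / e / sinh (pi * e / h)) * A\<^sub>2 + V * ((x - a) / (R - r)) * (2 * e)
                 + (h / e / sinh (pi * e / h)) * A\<^sub>1 + V * ((x - a) / (R - r)) * (2 * e)"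
  proof -
    have horiz: "norm (T (of_real (-R) + \<i> * of_real y) (of_real R + \<i> * of_real y)) \<le> (h / e / sinh (pi * e / h)) * A"
      if y: "\<bar>y\<bar> = e" and A: "integral {-R..R} (\<lambda>s. norm (g (of_real s + \<i> * of_real y))) \<le> A" for y A
      unfolding T_def
    proof (rule norm_contour_integral_horizontal_le)
      show int: "(\<lambda>s. norm (g (of_real s + \<i> * of_real y))) integrable_on {-R..R}"
        by (intro integrable_continuous_real continuous_intros
              continuous_on_compose2[OF holomorphic_on_imp_continuous_on[OF hol]]) (use y e in auto)
      have "0 \<le> integral {-R..R} (\<lambda>s. norm (g (of_real s + \<i> * of_real y)))"
        by (rule integral_nonneg[OF int]) auto
      thus "0 \<le> A" using A by linarith
      fix s
      let ?z = "of_real s + \<i> * of_real y"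
      have "norm (I ?z) \<le> pi / (?c * \<bar>Im ?z\<bar>)"
        unfolding I_def by (rule norm_integral_sin_kernel_le) (use c y e ax in auto)
      hence I: "norm (I ?z) \<le> h / e" using y by simp
      have "sinh (pi * e / h) = sinh \<bar>Im (of_real ?c * ?z)\<bar>" using y h by (simp add: abs_mult)
      also have "\<dots> \<le> norm (sin (of_real ?c * ?z))" by (rule norm_sin_ge_sinh)
      finally have sn: "sinh (pi * e / h) \<le> norm (sin (of_real ?c * ?z))" .
      have sp: "sinh (pi * e / h) > 0" using h e by simp
      have "norm (G ?z * I ?z) = norm (g ?z) / norm (sin (of_real ?c * ?z)) * norm (I ?z)"
        by (simp add: G_def norm_mult norm_divide)
      also have "\<dots> \<le> norm (g ?z) / sinh (pi * e / h) * (h / e)"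
        using sn sp I by (intro mult_mono divide_left_mono) (auto intro!: mult_pos_pos)
      finally show "norm (G ?z * I ?z) \<le> h / e / sinh (pi * e / h) * norm (g ?z)"
        by (simp add: mult_ac)
    qed (use A R0 h e in auto)
    have vert: "norm (T p q) \<le> V * ((x - a) / (R - r)) * (2 * e)"
      if "\<And>z. z \<in> closed_segment p q \<Longrightarrow> \<bar>Re z\<bar> = R \<and> \<bar>Im z\<bar> \<le> e" and pq: "norm (q - p) = 2 * e" for p q
    proof -
      have V0: "V \<ge> 0" using order_trans[OF norm_ge_zero V[of p]] that(1)[of p] by auto
      have "norm (T p q) \<le> V * ((x - a) / (R - r)) * norm (q - p)"
        unfolding T_def
      proof (rule norm_contour_integral_linepath_le)
        show "0 \<le> V * ((x - a) / (R - r))" using V0 ax r by auto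
        fix z assume "z \<in> closed_segment p q"
        hence z: "\<bar>Re z\<bar> = R" "\<bar>Im z\<bar> \<le> e" using that(1) by auto
        have dist: "norm (z - of_real t) \<ge> R - r" if "t \<in> {a..x}" for t
          using abs_Re_le_cmod[of "z - of_real t"] z(1) that r by auto
        have "norm (I z) \<le> 1 / (R - r) * (x - a)"
          unfolding I_def
        proof (rule integral_bound)
          show "continuous_on {a..x} (\<lambda>t. complex_of_real (sin (?c * t)) / (z - of_real t))"
            using dist r by (intro continuous_intros) force
          fix t assume "t \<in> {a..x}"
          thus "norm (complex_of_real (sin (?c * t)) / (z - of_real t)) \<le> 1 / (R - r)"
            unfolding norm_divide using dist r by (intro frac_le) auto
        qed (use ax in auto)
        moreover have "norm (G z) \<le> V"
        proof -
          have "1 \<le> norm (sin (of_real ?c * z))"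
            using sinR[OF z(1)] norm_sin_ge_abs_sin[of "of_real ?c * z"] by auto
          hence "norm (g z) / norm (sin (of_real ?c * z)) \<le> V / 1"
            using V[OF z] V0 by (intro frac_le) auto
          thus ?thesis by (simp add: G_def norm_divide)
        qed
        ultimately show "norm (G z * I z) \<le> V * ((x - a) / (R - r))"
          unfolding norm_mult using V0 by (intro mult_mono) auto
      qed
      thus ?thesis unfolding pq .
    qed
    have "norm (T p1 p2) \<le> (h / e / sinh (pi * e / h)) * A\<^sub>2"
      using horiz[of "-e" A\<^sub>2] A2 e by (simp add: p1_def p2_def complex_eq_iff Complex_eq)
    moreover have "norm (T p3 p4) \<le> (h / e / sinh (pi * e / h)) * A\<^sub>1"
    proof -
      \<comment> \<open>The top side is traversed from right to left.\<close>
      have "T p3 p4 = - T p4 p3"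
        unfolding T_def by (subst contour_integral_reversepath[symmetric]) auto
      hence "norm (T p3 p4) = norm (T p4 p3)" by simp
      thus ?thesis using horiz[of e A\<^sub>1] A1 e by (simp add: p3_def p4_def Complex_eq)
    qed
    moreover have "norm (T p2 p3) \<le> V * ((x - a) / (R - r)) * (2 * e)"
      by (rule vert) (use e R0 in \<open>auto simp: p2_def p3_def closed_segment_same_Re closed_segment_eq_real_ivl cmod_def real_sqrt_mult\<close>)
    moreover have "norm (T p4 p1) \<le> V * ((x - a) / (R - r)) * (2 * e)"
      by (rule vert) (use e R0 in \<open>auto simp: p4_def p1_def closed_segment_same_Re closed_segment_eq_real_ivl cmod_def real_sqrt_mult\<close>)
    ultimately show ?thesis by linarith
  qed
  also have "\<dots> = (A\<^sub>1 + A\<^sub>2) * (h / e) / sinh (pi * e / h) + 4 * e * V * (x - a) / (R - r)"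
  proof -
    have *: "X * A\<^sub>2 + Y * (2 * e) + X * A\<^sub>1 + Y * (2 * e) = (A\<^sub>1 + A\<^sub>2) * X + 4 * e * Y" for X Y
      by (simp add: algebra_simps)
    show ?thesis unfolding * by simp
  qed
  finally have "norm (integral {a..x} W) \<le> ((A\<^sub>1 + A\<^sub>2) * (h / e) / sinh (pi * e / h) + 4 * e * V * (x - a) / (R - r)) / (2 * pi)"
    by (subst pos_le_divide_eq) (simp_all only: mult.commute pi_gt_zero mult_pos_pos zero_less_numeral)
  moreover have "integral {a..x} W = integral {a..x} (\<lambda>t. g (of_real t)) - (\<Sum>k = - int m..int m. g (of_real (of_int k * h)) *
            of_real (integral {a..x} (\<lambda>t. sinc (pi * (t/h - of_int k)))))"
  proof -
    have gi: "(\<lambda>t. g (of_real t)) integrable_on {a..x}"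
      by (intro integrable_continuous_real continuous_intros
            continuous_on_compose2[OF holomorphic_on_imp_continuous_on[OF hol]]) (use e in auto)
    have si: "((\<lambda>t. of_real (sinc (pi * (t/h - of_int k)))) has_integral
             complex_of_real (integral {a..x} (\<lambda>t. sinc (pi * (t/h - of_int k))))) {a..x}" for k :: int
      by (intro has_integral_of_real integrable_integral integrable_continuous_real continuous_intros)
         (use h in auto)
    show ?thesis unfolding W_def
      by (intro integral_unique has_integral_diff integrable_integral gi has_integral_sum
                has_integral_mult_right si) auto
  qed
  ultimately show ?thesis by simp
qed

section \<open>Double exponential decay\<close>

text \<open>
  The function is in general not yet decreasing from \<open>sinh s = 1 / (2 b)\<close> on, nor from the thresholds
  given by \<^const>\<open>xg\<close>; monotonicity up to a constant factor suffices for comparing sums with integrals.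
\<close>
lemma cosh_exp_sinh_almost_antimono:
  fixes b s s' :: real
  assumes b: "b > 0" and s: "0 \<le> s" "s \<le> s'" and sinh_s: "1 / (2 * b) \<le> sinh s"
  shows "cosh s' * exp (- (b * sinh s')) \<le> 3/2 * (cosh s * exp (- (b * sinh s)))"
proof -
  define \<delta> where "\<delta> = sinh s' - sinh s"
  define v where "v = 2 * b * \<delta>"
  have pos: "sinh s > 0" using b sinh_s by (meson less_le_trans mult_pos_pos zero_less_divide_1_iff zero_less_numeral)
  have \<delta>: "\<delta> \<ge> 0" using s by (simp add: \<delta>_def)
  have v: "v \<ge> 0" using \<delta> b by (simp add: v_def)
  have "cosh s' * sinh s \<le> sinh s' * cosh s"
    using sinh_diff[of s' s] s sinh_real_nonneg_iff[of "s' - s"] by linarith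
  hence "cosh s' \<le> cosh s * (sinh s' / sinh s)"
    using pos by (simp add: field_simps)
  also have "sinh s' / sinh s = 1 + \<delta> * (1 / sinh s)"
    using pos by (simp add: \<delta>_def field_simps)
  also have "\<dots> \<le> 1 + \<delta> * (2 * b)"
  proof -
    have "1 / sinh s \<le> 2 * b" using sinh_s b pos by (simp add: field_simps)
    thus ?thesis using \<delta> by (intro add_left_mono mult_left_mono) auto
  qed
  also have "1 + \<delta> * (2 * b) = 1 + v" by (simp add: v_def)
  \<comment> \<open>Here \<open>exp (v / 2)\<close> is exactly the ratio of the two exponential
    weights, and the quadratic Taylor polynomial already yields the constant
    \<open>3/2\<close>.\<close>
  also have "1 + v \<le> 3/2 * exp (v / 2)"
  proof -
    have "3/2 * (1 + v/2 + (v/2)^2 / 2) \<le> 3/2 * exp (v/2)"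
      using exp_lower_Taylor_quadratic[of "v/2"] v by (intro mult_left_mono) auto
    moreover have "1 + v \<le> 3/2 * (1 + v/2 + (v/2)^2 / 2)"
      using zero_le_power2[of "v - 2/3"] by (simp add: power2_eq_square field_simps)
    ultimately show ?thesis by (rule order_trans[rotated])
  qed
  finally have "cosh s' \<le> cosh s * (3/2 * exp (v / 2))" by simp
  hence "cosh s' * exp (- (b * sinh s')) \<le> cosh s * (3/2 * exp (v / 2)) * exp (- (b * sinh s'))"
    by (intro mult_right_mono) auto
  also have "\<dots> = 3/2 * (cosh s * (exp (v / 2) * exp (- (b * sinh s'))))" by simp
  also have "exp (v / 2) * exp (- (b * sinh s')) = exp (- (b * sinh s))"
    unfolding exp_add[symmetric] by (simp add: v_def \<delta>_def field_simps)
  finally show ?thesis by simp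
qed

text \<open>By the mean value theorem, each increment of the antiderivative is \<open>h * b\<close>
  times the summand at an intermediate point, and the summand at the right end is at most
  \<open>3/2\<close> times that. The second exponential stays on the right-hand side so that the
  induction telescopes.\<close>

lemma sum_cosh_exp_sinh_le:
  fixes b h :: real and N m :: int
  assumes b: "b > 0" and h: "h > 0" and N: "0 \<le> N" and sinh_N: "1 / (2 * b) \<le> sinh (of_int N * h)"
    and "N \<le> m"
  shows "h * (\<Sum>k = N + 1..m. cosh (of_int k * h) * exp (- (b * sinh (of_int k * h))))
           \<le> 3 / (2 * b) * (exp (- (b * sinh (of_int N * h))) - exp (- (b * sinh (of_int m * h))))"
  using \<open>N \<le> m\<close>
proof (induction m rule: int_ge_induct)
  case base
  show ?case by simp
next
  case (step m)
  let ?H = "\<lambda>s. cosh s * exp (- (b * sinh s))"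
  let ?p = "of_int m * h" and ?q = "of_int (m + 1) * h"
  have pq: "?p < ?q" using h by (simp add: algebra_simps)
  have "\<exists>\<xi>>?p. \<xi> < ?q \<and> - exp (- (b * sinh ?q)) - (- exp (- (b * sinh ?p))) = (?q - ?p) * (b * ?H \<xi>)"
    by (rule MVT2[OF pq]) (auto intro!: derivative_eq_intros)
  then obtain \<xi> where \<xi>: "?p < \<xi>" "\<xi> < ?q"
    "exp (- (b * sinh ?p)) - exp (- (b * sinh ?q)) = h * (b * ?H \<xi>)"
    by (auto simp: algebra_simps)
  have Np: "of_int N * h \<le> ?p" using step.hyps h by simp
  have N0: "0 \<le> of_int N * h" using N h by simp
  have "1 / (2 * b) \<le> sinh \<xi>"
    by (rule order_trans[OF sinh_N]) (use Np \<xi>(1) in simp)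
  hence "?H ?q \<le> 3/2 * ?H \<xi>"
    using \<xi> Np N0 b by (intro cosh_exp_sinh_almost_antimono) auto
  hence "h * ?H ?q \<le> h * (3/2 * ?H \<xi>)" using h by (intro mult_left_mono) auto
  also have "\<dots> = 3 / (2 * b) * (h * (b * ?H \<xi>))" using b by simp
  also have "\<dots> = 3 / (2 * b) * (exp (- (b * sinh ?p)) - exp (- (b * sinh ?q)))" by (simp only: \<xi>(3))
  finally have "h * ?H ?q \<le> 3 / (2 * b) * (exp (- (b * sinh ?p)) - exp (- (b * sinh ?q)))" .
  moreover have "{N + 1..m + 1} = insert (m + 1) {N + 1..m}" using step.hyps by auto
  hence "h * (\<Sum>k = N + 1..m + 1. ?H (of_int k * h)) = h * ?H ?q + h * (\<Sum>k = N + 1..m. ?H (of_int k * h))"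
    by (simp add: distrib_left)
  ultimately show ?case using step.IH by (simp add: right_diff_distrib)
qed

lemma integral_cosh_exp_abs_sinh_le:
  fixes b R :: real
  assumes b: "b > 0" and R: "R \<ge> 0"
  shows "(\<lambda>s. cosh s * exp (- (b * \<bar>sinh s\<bar>))) integrable_on {-R..R}"
    and "integral {-R..R} (\<lambda>s. cosh s * exp (- (b * \<bar>sinh s\<bar>))) \<le> 2 / b"
proof -
  let ?H = "\<lambda>s. cosh s * exp (- (b * \<bar>sinh s\<bar>))"
  have "(?H has_integral exp (b * sinh 0) / b - exp (b * sinh (-R)) / b) {-R..0}"
  proof (rule fundamental_theorem_of_calculus)
    fix s assume "s \<in> {-R..0}"
    hence "b * sinh s = - (b * \<bar>sinh s\<bar>)" using b by simp
    moreover have "((\<lambda>s. exp (b * sinh s) / b) has_real_derivative cosh s * exp (b * sinh s)) (at s)"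
      using b by (auto intro!: derivative_eq_intros)
    ultimately show "((\<lambda>s. exp (b * sinh s) / b) has_vector_derivative ?H s) (at s within {-R..0})"
      by (metis has_real_derivative_iff_has_vector_derivative has_field_derivative_at_within)
  qed (use R in auto)
  moreover have "(?H has_integral - exp (- (b * sinh R)) / b - - exp (- (b * sinh 0)) / b) {0..R}"
  proof (rule fundamental_theorem_of_calculus)
    fix s assume "s \<in> {0..R}"
    hence "- (b * sinh s) = - (b * \<bar>sinh s\<bar>)" using b by simp
    moreover have "((\<lambda>s. - exp (- (b * sinh s)) / b) has_real_derivative cosh s * exp (- (b * sinh s))) (at s)"
      using b by (auto intro!: derivative_eq_intros)
    ultimately show "((\<lambda>s. - exp (- (b * sinh s)) / b) has_vector_derivative ?H s) (at s within {0..R})"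
      by (metis has_real_derivative_iff_has_vector_derivative has_field_derivative_at_within)
  qed (use R in auto)
  ultimately have I: "(?H has_integral (exp (b * sinh 0) / b - exp (b * sinh (-R)) / b)
      + (- exp (- (b * sinh R)) / b - - exp (- (b * sinh 0)) / b)) {-R..R}"
    by (rule has_integral_combine[rotated 2]) (use R in auto)
  thus "?H integrable_on {-R..R}" by blast
  have "integral {-R..R} ?H = 2 / b - 2 * (exp (- (b * sinh R)) / b)"
    using integral_unique[OF I] by (simp add: diff_divide_distrib)
  thus "integral {-R..R} ?H \<le> 2 / b" using b by simp
qed

text \<open>Meant for the vertical sides, where the size of the bound is irrelevant: it is divided
  by a length that tends to infinity.\<close>

lemma cosh_exp_sinh_bounded:
  fixes b s :: real
  assumes "b > 0"
  shows "cosh s * exp (- (b * \<bar>sinh s\<bar>)) \<le> 1 + 1 / b"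
proof -
  have "cosh s = cosh \<bar>s\<bar>" by simp
  also have "\<dots> \<le> 1 + \<bar>sinh s\<bar>"
    using cosh_minus_sinh[of "\<bar>s\<bar>"] exp_le_one_iff[of "- \<bar>s\<bar>"] unfolding sinh_real_abs by linarith
  finally have "cosh s * exp (- (b * \<bar>sinh s\<bar>)) \<le> (1 + \<bar>sinh s\<bar>) * exp (- (b * \<bar>sinh s\<bar>))"
    by (intro mult_right_mono) auto
  also have "\<dots> = exp (- (b * \<bar>sinh s\<bar>)) + \<bar>sinh s\<bar> * exp (- (b * \<bar>sinh s\<bar>))" by (simp add: distrib_right)
  also have "\<dots> \<le> 1 + 1 / b"
  proof (rule add_mono)
    show "exp (- (b * \<bar>sinh s\<bar>)) \<le> 1" using assms by simp
    have "b * \<bar>sinh s\<bar> \<le> exp (b * \<bar>sinh s\<bar>)" using exp_ge_add_one_self[of "b * \<bar>sinh s\<bar>"] by linarith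
    thus "\<bar>sinh s\<bar> * exp (- (b * \<bar>sinh s\<bar>)) \<le> 1 / b" using assms by (simp add: exp_minus field_simps)
  qed
  finally show ?thesis .
qed

section \<open>The transformed integrand\<close>

lemma has_field_derivative_psi:
  "(psi has_field_derivative of_real (pi/2) * cosh z * cosh (of_real (pi/2) * sinh z)) (at z)"
  unfolding psi_def[abs_def] by (auto intro!: derivative_eq_intros)

lemma one_plus_psi_square: "1 + psi z ^ 2 = cosh (of_real (pi/2) * sinh z) ^ 2"
  unfolding psi_def by (simp add: cosh_square_eq)

text \<open>The factor in parentheses is the derivative of \<open>psi\<close>, written out so that
  its modulus can be combined with the bound on \<open>f\<close>.\<close>

definition de_integrand :: "(complex \<Rightarrow> complex) \<Rightarrow> complex \<Rightarrow> complex" where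
  "de_integrand f z = f (psi z) * (of_real (pi/2) * cosh z * cosh (of_real (pi/2) * sinh z))"

lemma cos_pi_half_sin_pos:
  fixes y :: real
  assumes "\<bar>y\<bar> < pi/2"
  shows "cos (pi/2 * sin y) > 0"
proof -
  have "cos y > 0" using assms by (intro cos_gt_zero_pi) auto
  hence "sin y ^2 < 1^2"
    using sin_cos_squared_add[of y] zero_less_power[of "cos y" 2] unfolding power_one by linarith
  hence "\<bar>sin y\<bar> < 1" by (simp add: abs_square_less_1)
  thus ?thesis
    using mult_strict_left_mono[of "-1" "sin y" "pi/2"] mult_strict_left_mono[of "sin y" 1 "pi/2"]
    by (intro cos_gt_zero_pi) auto
qed

text \<open>Since \<open>1 + psi z ^ 2\<close> is the square of \<open>cosh (pi/2 * sinh z)\<close>,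
  the bound on \<open>f\<close> provides the power \<open>-(b + 1)\<close> of that modulus and the
  derivative of \<open>psi\<close> takes one power back. The remaining power \<open>-b\<close> is
  controlled by \<open>norm_cosh_sinh_ge\<close>.\<close>

lemma norm_de_integrand_le:
  fixes z :: complex and K b :: real
  assumes z: "\<bar>Im z\<bar> < pi/2" and b: "b > 0" and K: "K > 0"
    and bound: "norm (f (psi z)) \<le> K * norm (1 + psi z ^ 2) powr (- (b + 1) / 2)"
  shows "norm (de_integrand f z) \<le> K * (pi/2) * (2 / cos (pi/2 * sin (Im z))) powr b *
           (cosh (Re z) * exp (- (b * (pi/2 * cos (Im z)) * \<bar>sinh (Re z)\<bar>)))"
proof -
  define q where "q = norm (cosh (complex_of_real (pi/2) * sinh z))"
  define C where "C = cos (pi/2 * sin (Im z))"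
  define w where "w = pi/2 * cos (Im z) * \<bar>sinh (Re z)\<bar>"
  have C: "C > 0" unfolding C_def using z by (rule cos_pi_half_sin_pos)
  \<comment> \<open>The loss in \<open>cosh w \<ge> exp w / 2\<close> is the origin of the factor
    \<open>2 powr \<nu>\<close> in the final constant.\<close>
  have "C * (exp w / 2) \<le> C * cosh w"
    using C by (intro mult_left_mono) (auto simp: cosh_def field_simps)
  also have "cosh w = cosh (pi/2 * cos (Im z) * sinh (Re z))"
    unfolding w_def by (cases "Re z \<ge> 0") auto
  also have "C * \<dots> \<le> q"
    unfolding C_def q_def using z by (intro norm_cosh_sinh_ge) auto
  finally have q_ge: "C * (exp w / 2) \<le> q" .
  have Ce: "0 < C * (exp w / 2)" using C by simp
  hence q: "q > 0" using q_ge by linarith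
  have "norm (de_integrand f z) = norm (f (psi z)) * (pi/2 * norm (cosh z) * q)"
    by (simp add: de_integrand_def norm_mult q_def)
  also have "\<dots> \<le> (K * q powr (- (b + 1))) * (pi/2 * cosh (Re z) * q)"
  proof (intro mult_mono)
    have "norm (1 + psi z ^ 2) powr (- (b + 1) / 2) = (q powr 2) powr (- (b + 1) / 2)"
      unfolding one_plus_psi_square norm_power q_def[symmetric] using q by (simp add: powr_numeral)
    also have "\<dots> = q powr (- (b + 1))" unfolding powr_powr by (rule arg_cong) (simp add: field_simps)
    finally show "norm (f (psi z)) \<le> K * q powr (- (b + 1))" using bound by simp
    have "norm (cosh z)^2 \<le> cosh (Re z)^2" by (simp add: norm_cosh_square)
    thus "norm (cosh z) \<le> cosh (Re z)" by (rule power2_le_imp_le) simp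
  qed (use q K in auto)
  also have "\<dots> = K * (pi/2) * (q powr (- (b + 1)) * q powr 1) * cosh (Re z)"
    using q by simp
  also have "q powr (- (b + 1)) * q powr 1 = q powr (- b)"
    unfolding powr_add[symmetric] by simp
  also have "K * (pi/2) * q powr (- b) * cosh (Re z) \<le> K * (pi/2) * (C * (exp w / 2)) powr (- b) * cosh (Re z)"
    using K b Ce q_ge by (intro mult_right_mono mult_left_mono powr_mono2') auto
  also have "(C * (exp w / 2)) powr (- b) = ((C / 2) * exp w) powr (- b)" by simp
  also have "\<dots> = (C / 2) powr (- b) * exp w powr (- b)" by (subst powr_mult) (use C in auto)
  also have "(C / 2) powr (- b) = (2 / C) powr b"
    using C by (simp add: powr_minus powr_divide)
  also have "exp w powr (- b) = exp (- (b * (pi/2 * cos (Im z)) * \<bar>sinh (Re z)\<bar>))"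
    by (simp add: w_def powr_def mult_ac)
  finally show ?thesis by (simp add: C_def mult_ac)
qed

section \<open>Integrated cardinal functions\<close>

lemma integral_sinc_scaled:
  fixes h a x \<kappa> :: real
  assumes h: "h > 0" and "a \<le> x"
  shows "integral {a..x} (\<lambda>t. sinc (pi * (t/h - \<kappa>))) = h / pi * (Si (pi * (x/h - \<kappa>)) - Si (pi * (a/h - \<kappa>)))"
proof -
  have "((\<lambda>t. sinc (pi * (t/h - \<kappa>))) has_integral
          h / pi * Si (pi * (x/h - \<kappa>)) - h / pi * Si (pi * (a/h - \<kappa>))) {a..x}"
  proof (rule fundamental_theorem_of_calculus[OF \<open>a \<le> x\<close>])
    fix t assume "t \<in> {a..x}"
    have "((\<lambda>t. Si (pi * (t/h - \<kappa>))) has_real_derivative sinc (pi * (t/h - \<kappa>)) * (pi * (1 / h))) (at t)"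
      by (rule DERIV_chain2[OF DERIV_Si]) (use h in \<open>auto intro!: derivative_eq_intros\<close>)
    hence "((\<lambda>t. h / pi * Si (pi * (t/h - \<kappa>))) has_real_derivative
              h / pi * (sinc (pi * (t/h - \<kappa>)) * (pi * (1 / h)))) (at t)"
      by (rule DERIV_cmult)
    also have "h / pi * (sinc (pi * (t/h - \<kappa>)) * (pi * (1 / h))) = sinc (pi * (t/h - \<kappa>))"
      using h by (simp only: field_simps) simp
    finally show "((\<lambda>t. h / pi * Si (pi * (t/h - \<kappa>))) has_vector_derivative sinc (pi * (t/h - \<kappa>)))
            (at t within {a..x})"
      by (simp only: has_real_derivative_iff_has_vector_derivative[symmetric] has_field_derivative_at_within)
  qed
  from integral_unique[OF this] show ?thesis by (simp only: right_diff_distrib)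
qed

text \<open>Uniformity in the end points and in \<kappa> is the point: the discarded terms can be
  summed before any limit is taken.\<close>

lemma abs_integral_sinc_scaled_le:
  fixes h a x \<kappa> :: real
  assumes h: "h > 0" and "a \<le> x"
  shows "\<bar>integral {a..x} (\<lambda>t. sinc (pi * (t/h - \<kappa>)))\<bar> \<le> 2 * h"
proof -
  have "\<bar>Si (pi * (x/h - \<kappa>)) - Si (pi * (a/h - \<kappa>))\<bar> \<le> 2 * pi"
    using abs_Si_le_3[of "pi * (x/h - \<kappa>)"] abs_Si_le_3[of "pi * (a/h - \<kappa>)"] pi_gt3 by linarith
  hence "h / pi * \<bar>Si (pi * (x/h - \<kappa>)) - Si (pi * (a/h - \<kappa>))\<bar> \<le> h / pi * (2 * pi)"
    using h by (intro mult_left_mono) auto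
  thus ?thesis unfolding integral_sinc_scaled[OF assms] using h by (simp add: abs_mult)
qed

text \<open>The hypotheses apart from the number of nodes; the estimates hold for any step size
  \<open>h\<close> until it is tied to \<open>n\<close>.\<close>

locale de_decay =
  fixes f :: "complex \<Rightarrow> complex" and d K \<alpha> \<beta> :: real
  assumes d_pos: "0 < d" and d_lt: "d < pi/2"
    and f_an: "f analytic_on (psi ` strip d)"
    and K_pos: "K > 0" and \<alpha>_pos: "\<alpha> > 0" and \<beta>_pos: "\<beta> > 0"
    and bound_minus: "\<And>z. z \<in> psi ` strip_minus d \<Longrightarrow>
                        norm (f z) \<le> K * norm (1 + z^2) powr (- (\<alpha> + 1) / 2)"
    and bound_plus: "\<And>z. z \<in> psi ` strip_plus d \<Longrightarrow>
                        norm (f z) \<le> K * norm (1 + z^2) powr (- (\<beta> + 1) / 2)"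
begin

abbreviation g where "g \<equiv> de_integrand f"
abbreviation \<mu> where "\<mu> \<equiv> min \<alpha> \<beta>"
abbreviation \<nu> where "\<nu> \<equiv> max \<alpha> \<beta>"

lemma g_holomorphic: "g holomorphic_on {z. \<bar>Im z\<bar> < d}"
proof -
  have "(\<lambda>z. f (psi z)) holomorphic_on {z. \<bar>Im z\<bar> < d}"
    unfolding holomorphic_on_def
  proof
    fix z assume "z \<in> {z. \<bar>Im z\<bar> < d}"
    hence "f analytic_on {psi z}"
      using f_an by (rule_tac analytic_on_subset) (auto simp: strip_def)
    hence "f field_differentiable (at (psi z))"
      by (simp add: analytic_on_imp_differentiable_at)
    moreover have "psi field_differentiable (at z)"
      using has_field_derivative_psi[of z] by (auto simp: field_differentiable_def)
    ultimately have "(f \<circ> psi) field_differentiable (at z)"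
      by (intro field_differentiable_compose)
    thus "(\<lambda>z. f (psi z)) field_differentiable (at z within {z. \<bar>Im z\<bar> < d})"
      by (simp add: o_def field_differentiable_at_within)
  qed
  thus ?thesis
    unfolding de_integrand_def[abs_def] cosh_def sinh_def scaleR_conv_of_real by (intro holomorphic_intros)
qed

lemma norm_g_le:
  assumes z: "\<bar>Im z\<bar> < d"
  shows "norm (g z) \<le> K * (pi/2) * (2 / cos (pi/2 * sin (Im z))) powr (if Re z < 0 then \<alpha> else \<beta>) *
           (cosh (Re z) * exp (- ((if Re z < 0 then \<alpha> else \<beta>) * (pi/2 * cos (Im z)) * \<bar>sinh (Re z)\<bar>)))"
proof (cases "Re z < 0")
  case True
  hence "psi z \<in> psi ` strip_minus d" using z by (auto simp: strip_minus_def strip_def)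
  from norm_de_integrand_le[where f = f and z = z, OF _ \<alpha>_pos K_pos bound_minus[OF this]] True z d_lt show ?thesis by simp
next
  case False
  hence "psi z \<in> psi ` strip_plus d" using z by (auto simp: strip_plus_def strip_def)
  from norm_de_integrand_le[where f = f and z = z, OF _ \<beta>_pos K_pos bound_plus[OF this]] False z d_lt show ?thesis by simp
qed

text \<open>Within height \<open>e\<close> the largest constant and the slowest rate occur at the
  boundary; \<nu> in the constant and \<mu> in the rate cover both half-planes. Raising the exponent
  to \<nu> is allowed because the base is at least \<open>1\<close>.\<close>

lemma norm_g_le_strip:
  assumes e: "0 \<le> e" "e < d" and z: "\<bar>Im z\<bar> \<le> e"
  shows "norm (g z) \<le> K * (pi/2) * (2 / cos (pi/2 * sin e)) powr \<nu> *
           (cosh (Re z) * exp (- (\<mu> * (pi/2 * cos e) * \<bar>sinh (Re z)\<bar>)))"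
proof -
  define b where "b = (if Re z < 0 then \<alpha> else \<beta>)"
  have b: "\<mu> \<le> b" "b \<le> \<nu>" "b > 0" using \<alpha>_pos \<beta>_pos by (auto simp: b_def)
  define y where "y = \<bar>Im z\<bar>"
  have y: "0 \<le> y" "y \<le> e" "e < pi/2" using z e d_lt by (auto simp: y_def)
  have "cos (Im z) = cos y" by (simp add: y_def)
  moreover have "cos e \<le> cos y" using y by (intro cos_monotone_0_pi_le) auto
  ultimately have cos: "cos e \<le> cos (Im z)" by simp
  have cos_e: "cos e > 0" using y by (intro cos_gt_zero_pi) auto
  have C_e: "cos (pi/2 * sin e) > 0" using y e by (intro cos_pi_half_sin_pos) auto
  have "cos (pi/2 * sin (Im z)) = cos (pi/2 * sin y)"
    by (cases "Im z \<ge> 0") (auto simp: y_def)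
  moreover have "cos (pi/2 * sin e) \<le> cos (pi/2 * sin y)"
  proof (rule cos_monotone_0_pi_le)
    have "sin y \<ge> 0" using y by (intro sin_ge_zero) auto
    thus "0 \<le> pi/2 * sin y" by simp
    show "pi/2 * sin y \<le> pi/2 * sin e" using y by (intro mult_left_mono sin_monotone_2pi_le) auto
    have "pi/2 * sin e \<le> pi/2 * 1" by (intro mult_left_mono) auto
    thus "pi/2 * sin e \<le> pi" using pi_gt_zero by linarith
  qed
  ultimately have C: "cos (pi/2 * sin e) \<le> cos (pi/2 * sin (Im z))" by simp
  have "norm (g z) \<le> K * (pi/2) * (2 / cos (pi/2 * sin (Im z))) powr b *
           (cosh (Re z) * exp (- (b * (pi/2 * cos (Im z)) * \<bar>sinh (Re z)\<bar>)))"
    unfolding b_def using norm_g_le[of z] e z by simp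
  also have "\<dots> \<le> K * (pi/2) * (2 / cos (pi/2 * sin e)) powr \<nu> *
           (cosh (Re z) * exp (- (\<mu> * (pi/2 * cos e) * \<bar>sinh (Re z)\<bar>)))"
  proof -
    have "(2 / cos (pi/2 * sin (Im z))) powr b \<le> (2 / cos (pi/2 * sin e)) powr b"
      using C C_e b by (intro powr_mono2 divide_left_mono) (auto intro: mult_pos_pos)
    also have "\<dots> \<le> (2 / cos (pi/2 * sin e)) powr \<nu>"
    proof (rule powr_mono)
      have "cos (pi/2 * sin e) \<le> 2" using cos_le_one[of "pi/2 * sin e"] by linarith
      thus "1 \<le> 2 / cos (pi/2 * sin e)" using C_e by simp
    qed (use b in auto)
    finally have P: "(2 / cos (pi/2 * sin (Im z))) powr b \<le> (2 / cos (pi/2 * sin e)) powr \<nu>" .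
    have "\<mu> * (pi/2 * cos e) * \<bar>sinh (Re z)\<bar> \<le> b * (pi/2 * cos (Im z)) * \<bar>sinh (Re z)\<bar>"
      using b cos cos_e by (intro mult_right_mono mult_mono) auto
    hence X: "exp (- (b * (pi/2 * cos (Im z)) * \<bar>sinh (Re z)\<bar>)) \<le> exp (- (\<mu> * (pi/2 * cos e) * \<bar>sinh (Re z)\<bar>))"
      by simp
    show ?thesis using P X K_pos by (intro mult_mono) auto
  qed
  finally show ?thesis .
qed

text \<open>On the real axis the cosine factors equal \<open>1\<close>. The two sides are kept apart
  to preserve the rates \<alpha> and \<beta>, to which \<open>M\<close> and \<open>N\<close> are
  adapted; \<open>0\<close> belongs to the right half.\<close>

lemma norm_g_real_le:
  assumes s: "s \<ge> 0"
  shows "norm (g (of_real s)) \<le> K * (pi/2) * 2 powr \<beta> * (cosh s * exp (- (\<beta> * (pi/2) * sinh s)))"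
    and "s > 0 \<Longrightarrow> norm (g (of_real (- s))) \<le> K * (pi/2) * 2 powr \<alpha> * (cosh s * exp (- (\<alpha> * (pi/2) * sinh s)))"
  using norm_g_le[of "of_real s"] norm_g_le[of "of_real (- s)"] s d_pos by auto

lemma sinc_rectangle_error:
  fixes h e a x :: real and m :: nat
  assumes h: "h > 0" and e: "0 < e" "e < d" and ax: "a < x"
    and R: "R = (real m + 1/2) * h" and r: "\<bar>a\<bar> \<le> r" "\<bar>x\<bar> \<le> r" "r < R"
  defines "Q \<equiv> (2 / cos (pi/2 * sin e)) powr \<nu>"
  shows "norm (integral {a..x} (\<lambda>t. g (of_real t)) - (\<Sum>k = - int m..int m. g (of_real (of_int k * h)) *
            of_real (integral {a..x} (\<lambda>t. sinc (pi * (t/h - of_int k))))))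
         \<le> 2 * K * Q / (\<mu> * cos e) * (h / e) / sinh (pi * e / h) / pi
            + 4 * e * (K * (pi/2) * Q * (1 + 1 / (\<mu> * (pi/2 * cos e)))) * (x - a) / (R - r) / (2 * pi)"
proof -
  define b where "b = \<mu> * (pi/2 * cos e)"
  have cos_e: "cos e > 0" using e d_lt by (intro cos_gt_zero_pi) auto
  have b: "b > 0" using cos_e \<alpha>_pos \<beta>_pos by (auto simp: b_def)
  have R0: "R > 0" using h by (auto simp: R intro: add_nonneg_pos)
  have Q0: "Q \<ge> 0" by (simp add: Q_def)
  have line: "integral {-R..R} (\<lambda>s. norm (g (of_real s + \<i> * of_real y))) \<le> 2 * K * Q / (\<mu> * cos e)"
    if y: "\<bar>y\<bar> = e" for y
  proof -
    have "integral {-R..R} (\<lambda>s. norm (g (of_real s + \<i> * of_real y)))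
        \<le> integral {-R..R} (\<lambda>s. K * (pi/2) * Q * (cosh s * exp (- (b * \<bar>sinh s\<bar>))))"
    proof (rule integral_le)
      show "(\<lambda>s. norm (g (of_real s + \<i> * of_real y))) integrable_on {-R..R}"
        by (intro integrable_continuous_real continuous_intros
              continuous_on_compose2[OF holomorphic_on_imp_continuous_on[OF g_holomorphic]]) (use y e in auto)
      show "(\<lambda>s. K * (pi/2) * Q * (cosh s * exp (- (b * \<bar>sinh s\<bar>)))) integrable_on {-R..R}"
        using integral_cosh_exp_abs_sinh_le(1)[OF b, of R] R0 by (intro integrable_on_mult_right) auto
      fix s
      show "norm (g (of_real s + \<i> * of_real y)) \<le> K * (pi/2) * Q * (cosh s * exp (- (b * \<bar>sinh s\<bar>)))"
        using norm_g_le_strip[of e "of_real s + \<i> * of_real y"] e y by (simp add: Q_def b_def)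
    qed
    also have "\<dots> = K * (pi/2) * Q * integral {-R..R} (\<lambda>s. cosh s * exp (- (b * \<bar>sinh s\<bar>)))"
      by (rule integral_mult_right)
    also have "\<dots> \<le> K * (pi/2) * Q * (2 / b)"
      using K_pos Q0 integral_cosh_exp_abs_sinh_le(2)[OF b, of R] R0 by (intro mult_left_mono) auto
    also have "\<dots> = 2 * K * Q / (\<mu> * cos e)" using cos_e by (simp add: b_def)
    finally show ?thesis .
  qed
  have vert: "norm (g z) \<le> K * (pi/2) * Q * (1 + 1 / b)" if "\<bar>Im z\<bar> \<le> e" for z
  proof -
    have "norm (g z) \<le> K * (pi/2) * Q * (cosh (Re z) * exp (- (b * \<bar>sinh (Re z)\<bar>)))"
      using norm_g_le_strip[of e z] e that by (simp add: Q_def b_def)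
    also have "\<dots> \<le> K * (pi/2) * Q * (1 + 1 / b)"
      using K_pos Q0 cosh_exp_sinh_bounded[OF b] by (intro mult_left_mono) auto
    finally show ?thesis .
  qed
  have "norm (integral {a..x} (\<lambda>t. g (of_real t)) - (\<Sum>k = - int m..int m. g (of_real (of_int k * h)) *
            of_real (integral {a..x} (\<lambda>t. sinc (pi * (t/h - of_int k))))))
     \<le> ((2 * K * Q / (\<mu> * cos e) + 2 * K * Q / (\<mu> * cos e)) * (h / e) / sinh (pi * e / h)
         + 4 * e * (K * (pi/2) * Q * (1 + 1 / b)) * (x - a) / (R - r)) / (2 * pi)"
    by (rule sinc_indefinite_rectangle_bound[OF g_holomorphic e h R ax r line line vert]) (use e in auto)
  also have "\<dots> = 2 * K * Q / (\<mu> * cos e) * (h / e) / sinh (pi * e / h) / pi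
         + 4 * e * (K * (pi/2) * Q * (1 + 1 / b)) * (x - a) / (R - r) / (2 * pi)"
    by (simp add: add_divide_distrib mult_ac)
  finally show ?thesis unfolding b_def .
qed

text \<open>The conditions on \<open>sinh\<close> are the threshold \<open>1 / (2 * b)\<close> of
  the almost monotone comparison for \<open>b = \<alpha> * (pi/2)\<close> and
  \<open>b = \<beta> * (pi/2)\<close>. The constant \<open>3\<close> collects the coefficient bound
  \<open>2 * h\<close>, the \<open>pi/2\<close> from the derivative of \<open>psi\<close> and the
  \<open>3 / (2 * b)\<close> of the sum. The bound is free of \<open>m\<close>.\<close>

lemma sinc_tail_le:
  fixes h :: real and M N m :: int and c :: "int \<Rightarrow> real"
  assumes h: "h > 0" and MN: "0 \<le> M" "0 \<le> N" "M \<le> m" "N \<le> m"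
    and M: "1 / (pi * \<alpha>) \<le> sinh (of_int M * h)" and N: "1 / (pi * \<beta>) \<le> sinh (of_int N * h)"
    and c: "\<And>k. \<bar>c k\<bar> \<le> 2 * h"
  shows "norm (\<Sum>k\<in>{- m..m} - {- M..N}. g (of_real (of_int k * h)) * of_real (c k))
      \<le> 3 * K * 2 powr \<alpha> / \<alpha> * exp (- (\<alpha> * (pi/2) * sinh (of_int M * h)))
       + 3 * K * 2 powr \<beta> / \<beta> * exp (- (\<beta> * (pi/2) * sinh (of_int N * h)))"
proof -
  let ?u = "\<lambda>k. g (of_real (of_int k * h)) * of_real (c k)"
  have one_side: "(\<Sum>k = L + 1..m. 2 * h * (K * (pi/2) * 2 powr \<gamma> * (cosh (of_int k * h) * exp (- (\<gamma> * (pi/2) * sinh (of_int k * h))))))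
      \<le> 3 * K * 2 powr \<gamma> / \<gamma> * exp (- (\<gamma> * (pi/2) * sinh (of_int L * h)))"
    if \<gamma>: "\<gamma> > 0" and L: "0 \<le> L" "L \<le> m" "1 / (pi * \<gamma>) \<le> sinh (of_int L * h)" for L \<gamma>
  proof -
    let ?b = "\<gamma> * (pi/2)"
    have "h * (\<Sum>k = L + 1..m. cosh (of_int k * h) * exp (- (?b * sinh (of_int k * h))))
       \<le> 3 / (2 * ?b) * (exp (- (?b * sinh (of_int L * h))) - exp (- (?b * sinh (of_int m * h))))"
      by (rule sum_cosh_exp_sinh_le) (use \<gamma> L h in \<open>auto simp: mult.commute\<close>)
    also have "\<dots> \<le> 3 / (2 * ?b) * exp (- (?b * sinh (of_int L * h)))"
      using \<gamma> by (intro mult_left_mono) auto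
    finally have "2 * (K * (pi/2) * 2 powr \<gamma>) * (h * (\<Sum>k = L + 1..m. cosh (of_int k * h) * exp (- (?b * sinh (of_int k * h)))))
        \<le> 2 * (K * (pi/2) * 2 powr \<gamma>) * (3 / (2 * ?b) * exp (- (?b * sinh (of_int L * h))))"
      using K_pos by (intro mult_left_mono) auto
    also have "\<dots> = 3 * K * 2 powr \<gamma> / \<gamma> * exp (- (?b * sinh (of_int L * h)))"
      by simp
    finally show ?thesis by (simp add: sum_distrib_left mult_ac)
  qed
  have "{- m..m} - {- M..N} = {- m..- (M + 1)} \<union> {N + 1..m}" using MN by auto
  hence "norm (\<Sum>k\<in>{- m..m} - {- M..N}. ?u k) = norm ((\<Sum>k = - m..- (M + 1). ?u k) + (\<Sum>k = N + 1..m. ?u k))"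
    using MN by (subst sum.union_disjoint[symmetric]) auto
  also have "(\<Sum>k = - m..- (M + 1). ?u k) = (\<Sum>k = M + 1..m. ?u (- k))"
    by (rule sum.reindex_bij_witness[of _ uminus uminus]) auto
  also have "norm ((\<Sum>k = M + 1..m. ?u (- k)) + (\<Sum>k = N + 1..m. ?u k))
     \<le> (\<Sum>k = M + 1..m. norm (?u (- k))) + (\<Sum>k = N + 1..m. norm (?u k))"
    by (intro order_trans[OF norm_triangle_ineq] add_mono norm_sum)
  also have "(\<Sum>k = M + 1..m. norm (?u (- k))) \<le>
      (\<Sum>k = M + 1..m. 2 * h * (K * (pi/2) * 2 powr \<alpha> * (cosh (of_int k * h) * exp (- (\<alpha> * (pi/2) * sinh (of_int k * h))))))"
  proof (rule sum_mono)
    fix k assume "k \<in> {M + 1..m}"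
    hence k: "of_int k * h > 0" using MN h by auto
    have "norm (?u (- k)) = \<bar>c (- k)\<bar> * norm (g (of_real (- (of_int k * h))))"
      by (simp add: norm_mult)
    also have "\<dots> \<le> 2 * h * (K * (pi/2) * 2 powr \<alpha> * (cosh (of_int k * h) * exp (- (\<alpha> * (pi/2) * sinh (of_int k * h)))))"
      using k h by (intro mult_mono c norm_g_real_le(2)) auto
    finally show "norm (?u (- k)) \<le> \<dots>" .
  qed
  also have "\<dots> \<le> 3 * K * 2 powr \<alpha> / \<alpha> * exp (- (\<alpha> * (pi/2) * sinh (of_int M * h)))"
    by (rule one_side) (use \<alpha>_pos MN M in auto)
  also have "(\<Sum>k = N + 1..m. norm (?u k)) \<le>
      (\<Sum>k = N + 1..m. 2 * h * (K * (pi/2) * 2 powr \<beta> * (cosh (of_int k * h) * exp (- (\<beta> * (pi/2) * sinh (of_int k * h))))))"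
  proof (rule sum_mono)
    fix k assume "k \<in> {N + 1..m}"
    hence k: "of_int k * h \<ge> 0" using MN h by auto
    have "norm (?u k) = \<bar>c k\<bar> * norm (g (of_real (of_int k * h)))"
      by (simp add: norm_mult)
    also have "\<dots> \<le> 2 * h * (K * (pi/2) * 2 powr \<beta> * (cosh (of_int k * h) * exp (- (\<beta> * (pi/2) * sinh (of_int k * h)))))"
      using k h by (intro mult_mono c norm_g_real_le(1)) auto
    finally show "norm (?u k) \<le> \<dots>" .
  qed
  also have "\<dots> \<le> 3 * K * 2 powr \<beta> / \<beta> * exp (- (\<beta> * (pi/2) * sinh (of_int N * h)))"
    by (rule one_side) (use \<beta>_pos MN N in auto)
  finally show ?thesis by simp
qed

end

section \<open>Passing to the limit\<close>

text \<open>The source of the summand \<open>1/2\<close> in \<open>J\<close>: integrating a cardinal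
  function from minus infinity adds \<open>pi/2\<close> to \<open>Si\<close>.\<close>

lemma Si_at_bot: "(Si \<longlongrightarrow> - (pi / 2)) at_bot"
proof -
  have "((\<lambda>x. - Si x) \<longlongrightarrow> - (pi / 2)) at_top" by (intro tendsto_minus Si_at_top)
  moreover have "eventually (\<lambda>x. - Si x = Si (- x)) at_top"
    using eventually_ge_at_top[of 0] by eventually_elim (simp add: Si_neg)
  ultimately have "((\<lambda>x. Si (- x)) \<longlongrightarrow> - (pi / 2)) at_top" by (rule Lim_transform_eventually)
  thus ?thesis by (simp add: filterlim_at_bot_mirror)
qed

lemma psi_r_psi_inv: "psi_r (psi_inv t) = t"
  by (simp add: psi_r_def psi_inv_def)

lemma sinh_complex_of_real: "sinh (complex_of_real x) = of_real (sinh x)"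
  and cosh_complex_of_real: "cosh (complex_of_real x) = of_real (cosh x)"
  by (simp_all add: sinh_def cosh_def scaleR_conv_of_real exp_of_real flip: of_real_minus)

lemma psi_of_real: "psi (of_real s) = of_real (psi_r s)"
  unfolding psi_def psi_r_def by (simp only: sinh_complex_of_real flip: of_real_mult)

lemma has_real_derivative_psi_r:
  "(psi_r has_real_derivative pi/2 * cosh s * cosh (pi/2 * sinh s)) (at s)"
  unfolding psi_r_def[abs_def] by (auto intro!: derivative_eq_intros)

lemma psi_r_mono: "a \<le> b \<Longrightarrow> psi_r a \<le> psi_r b"
  by (simp add: psi_r_def)

lemma psi_r_at_bot: "filterlim psi_r at_bot at_bot"
proof -
  have "filterlim (sinh :: real \<Rightarrow> real) at_bot at_bot" by (rule sinh_real_at_bot)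
  moreover have "filterlim (\<lambda>s::real. pi/2 * sinh s) at_bot at_bot"
    by (rule filterlim_tendsto_pos_mult_at_bot[OF tendsto_const _ calculation]) simp
  ultimately show ?thesis
    unfolding psi_r_def[abs_def] by (rule filterlim_compose)
qed

lemma de_integrand_of_real:
  "de_integrand f (of_real s) = f (of_real (psi_r s)) * of_real (deriv psi_r s)"
proof -
  have "of_real (pi/2) * cosh (complex_of_real s) * cosh (of_real (pi/2) * sinh (of_real s)) =
          complex_of_real (pi/2 * cosh s * cosh (pi/2 * sinh s))"
    by (simp only: sinh_complex_of_real cosh_complex_of_real flip: of_real_mult)
  thus ?thesis
    unfolding de_integrand_def psi_of_real DERIV_imp_deriv[OF has_real_derivative_psi_r] by simp
qed

text \<open>For \<open>\<gamma> = \<alpha>/2\<close> the left-hand side is the threshold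
  \<open>1 / (pi * \<alpha>)\<close> of the tail estimate. In the first branch of \<open>xg\<close>
  the outer root is at least \<open>1\<close>; in the second \<open>sinh (xg \<gamma>)\<close>
  equals \<open>1\<close>.\<close>

lemma sinh_xg_ge:
  assumes "\<gamma> > 0"
  shows "1 / (2 * pi * \<gamma>) \<le> sinh (xg \<gamma>)"
proof (cases "\<gamma> < 1 / (2*pi)")
  case True
  have "2 * pi * \<gamma> \<le> 1" using True by (simp add: field_simps)
  hence "(2 * pi * \<gamma>)^2 \<le> 1" using assms by (simp add: power_le_one)
  hence "1 \<le> sqrt (1 + sqrt (1 - (2*pi*\<gamma>)^2))" by simp
  thus ?thesis using True assms by (simp add: xg_def divide_right_mono)
next
  case False
  thus ?thesis using assms by (simp add: xg_def field_simps)
qed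

context de_decay begin

lemma continuous_on_f_real: "continuous_on A (\<lambda>t. f (complex_of_real t))"
proof (rule continuous_at_imp_continuous_on, intro ballI)
  fix t :: real
  have "complex_of_real t = psi (of_real (psi_inv t))"
    by (simp add: psi_of_real psi_r_psi_inv)
  hence "complex_of_real t \<in> psi ` strip d" using d_pos by (auto simp: strip_def)
  hence "isCont f (of_real t)"
    using f_an analytic_at_imp_isCont analytic_on_analytic_at by blast
  thus "isCont (\<lambda>t. f (complex_of_real t)) t"
    by (rule isCont_o2[rotated]) (auto intro: continuous_intros)
qed

lemma norm_f_neg_le:
  assumes "t < 0"
  shows "norm (f (of_real t)) \<le> K * (- t) powr (- (\<alpha> + 1))"
proof -
  have "psi_inv t < 0"
    using assms by (simp add: psi_inv_def divide_less_0_iff)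
  hence "psi (of_real (psi_inv t)) \<in> psi ` strip_minus d"
    using d_pos by (auto simp: strip_minus_def strip_def)
  hence "complex_of_real t \<in> psi ` strip_minus d" by (simp add: psi_of_real psi_r_psi_inv)
  from bound_minus[OF this]
  have "norm (f (of_real t)) \<le> K * norm (1 + complex_of_real t ^ 2) powr (- (\<alpha> + 1) / 2)" .
  also have "norm (1 + complex_of_real t ^ 2) = 1 + t^2"
  proof -
    have "1 + complex_of_real t ^ 2 = of_real (1 + t^2)" by simp
    thus ?thesis by (simp only: norm_of_real) simp
  qed
  also have "(1 + t^2) powr (- (\<alpha> + 1) / 2) \<le> ((- t) powr 2) powr (- (\<alpha> + 1) / 2)"
    using assms \<alpha>_pos by (intro powr_mono2') (auto simp: powr_numeral)
  also have "\<dots> = (- t) powr (- (\<alpha> + 1))"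
    unfolding powr_powr by (rule arg_cong) (simp add: field_simps)
  finally show ?thesis using K_pos by (simp add: mult_left_mono)
qed

text \<open>Absolute integrability makes the integral over the half-line a limit of integrals over
  bounded intervals. The majorant near minus infinity is a power with exponent below
  \<open>-1\<close>, as \<alpha> is positive.\<close>

lemma absolutely_integrable_f: "(\<lambda>t. f (of_real t)) absolutely_integrable_on {..\<tau>}"
proof -
  have meas: "(\<lambda>t. f (complex_of_real t)) \<in> borel_measurable (lebesgue_on S)" if "S \<in> sets lebesgue" for S
    by (rule continuous_imp_measurable_on_sets_lebesgue[OF continuous_on_f_real that])
  have "(\<lambda>t::real. K * t powr (- (\<alpha> + 1))) integrable_on {1..}"
    using has_integral_powr_to_inf[of "- (\<alpha> + 1)" 1] \<alpha>_pos
    by (intro integrable_on_mult_right) (auto simp: integrable_on_def)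
  hence "(\<lambda>t::real. K * t powr (- (\<alpha> + 1))) absolutely_integrable_on {1..}"
    using K_pos by (intro nonnegative_absolutely_integrable_1) auto
  hence "(\<lambda>t::real. K * (- t) powr (- (\<alpha> + 1))) absolutely_integrable_on {..-1}"
    using has_absolute_integral_reflect_real[of "{..-1}" "{1..}" "\<lambda>t::real. K * t powr (- (\<alpha> + 1))"]
    by auto
  hence "(\<lambda>t::real. K * (- t) powr (- (\<alpha> + 1))) integrable_on {..-1}"
    by (rule set_lebesgue_integral_eq_integral(1))
  moreover have "norm (f (of_real t)) \<le> K * (- t) powr (- (\<alpha> + 1))" if "t \<in> {..-1}" for t
    using that by (intro norm_f_neg_le) auto
  ultimately have "(\<lambda>t. f (of_real t)) absolutely_integrable_on {..-1}"
    by (intro measurable_bounded_by_integrable_imp_absolutely_integrable[OF meas]) auto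
  moreover have "(\<lambda>t. f (complex_of_real t)) absolutely_integrable_on {-1..\<tau>}"
    by (rule absolutely_integrable_continuous_real[OF continuous_on_f_real])
  \<comment> \<open>For \<open>\<tau> < -1\<close> the second interval is empty and the union
    exceeds the half-line, hence the passage to a subset afterwards.\<close>
  ultimately have "(\<lambda>t. f (complex_of_real t)) absolutely_integrable_on ({..-1} \<union> {-1..\<tau>})"
    by (rule absolutely_integrable_Un)
  thus ?thesis by (rule set_integrable_subset) auto
qed

lemma integral_g_eq:
  assumes "a \<le> x"
  shows "integral {a..x} (\<lambda>s. g (of_real s)) = integral {psi_r a..psi_r x} (\<lambda>t. f (of_real t))"
proof -
  have "((\<lambda>s. deriv psi_r s *\<^sub>R f (of_real (psi_r s))) has_integral
           integral {psi_r a..psi_r x} (\<lambda>t. f (of_real t))) {a..x}"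
  proof (rule has_integral_substitution[OF assms])
    show "psi_r ` {a..x} \<subseteq> {psi_r a..psi_r x}" by (auto intro: psi_r_mono)
    show "(psi_r has_field_derivative deriv psi_r s) (at s within {a..x})" for s
      using has_real_derivative_psi_r[of s] unfolding DERIV_imp_deriv[OF has_real_derivative_psi_r]
      by (rule has_field_derivative_at_within)
  qed (use assms in \<open>auto intro: psi_r_mono continuous_on_f_real\<close>)
  from integral_unique[OF this] show ?thesis
    by (simp add: de_integrand_of_real scaleR_conv_of_real mult.commute)
qed

lemma integral_f_limit:
  "((\<lambda>a. integral {a..x} (\<lambda>s. g (of_real s))) \<longlongrightarrow> integral {..psi_r x} (\<lambda>t. f (of_real t))) at_bot"
proof -
  let ?f = "\<lambda>t. f (complex_of_real t)" and ?\<tau> = "psi_r x"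
  have "((\<lambda>a. set_lebesgue_integral lebesgue {a..?\<tau>} ?f) \<longlongrightarrow> set_lebesgue_integral lebesgue {..?\<tau>} ?f) at_bot"
    by (rule tendsto_set_lebesgue_integral_at_bot[OF _ absolutely_integrable_f]) auto
  also have "set_lebesgue_integral lebesgue {..?\<tau>} ?f = integral {..?\<tau>} ?f"
    by (rule set_lebesgue_integral_eq_integral(2)[OF absolutely_integrable_f])
  also have "(\<lambda>a. set_lebesgue_integral lebesgue {a..?\<tau>} ?f) = (\<lambda>a. integral {a..?\<tau>} ?f)"
    by (intro ext set_lebesgue_integral_eq_integral(2) absolutely_integrable_continuous_real continuous_on_f_real)
  finally have "((\<lambda>a. integral {psi_r a..?\<tau>} ?f) \<longlongrightarrow> integral {..?\<tau>} ?f) at_bot"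
    by (rule filterlim_compose[OF _ psi_r_at_bot])
  moreover have "eventually (\<lambda>a. integral {psi_r a..?\<tau>} ?f = integral {a..x} (\<lambda>s. g (of_real s))) at_bot"
    using eventually_le_at_bot[of x] by eventually_elim (simp add: integral_g_eq)
  ultimately show ?thesis by (rule Lim_transform_eventually)
qed

text \<open>The share of the two horizontal sides at height \<open>e\<close>. As an explicit
  expression it is continuous up to \<open>e = d\<close>, where the bounds on \<open>f\<close> are
  no longer at hand.\<close>

definition discretization_bound :: "real \<Rightarrow> real \<Rightarrow> real" where
  "discretization_bound h e =
     2 * K * (2 / cos (pi/2 * sin e)) powr \<nu> / (\<mu> * cos e) * (h / e) / sinh (pi * e / h) / pi"

definition truncation_bound :: "real \<Rightarrow> int \<Rightarrow> int \<Rightarrow> real" where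
  "truncation_bound h M N =
     3 * K * 2 powr \<alpha> / \<alpha> * exp (- (\<alpha> * (pi/2) * sinh (of_int M * h)))
       + 3 * K * 2 powr \<beta> / \<beta> * exp (- (\<beta> * (pi/2) * sinh (of_int N * h)))"

text \<open>The quantity being bounded depends neither on \<open>m\<close> nor on \<open>e\<close>.
  For fixed \<open>e < d\<close> the limit in \<open>m\<close> removes the vertical sides; after
  that \<open>e\<close> increases to \<open>d\<close> in the explicit bound alone.\<close>

lemma sinc_finite_error:
  fixes h a x :: real and M N :: int
  assumes h: "h > 0" and ax: "a < x" and MN: "0 \<le> M" "0 \<le> N"
    and M: "1 / (pi * \<alpha>) \<le> sinh (of_int M * h)" and N: "1 / (pi * \<beta>) \<le> sinh (of_int N * h)"
  defines "c \<equiv> (\<lambda>k::int. integral {a..x} (\<lambda>t. sinc (pi * (t/h - of_int k))))"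
  shows "norm (integral {a..x} (\<lambda>t. g (of_real t)) - (\<Sum>k = - M..N. g (of_real (of_int k * h)) * of_real (c k)))
      \<le> discretization_bound h d + truncation_bound h M N"
proof -
  let ?X = "norm (integral {a..x} (\<lambda>t. g (of_real t)) - (\<Sum>k = - M..N. g (of_real (of_int k * h)) * of_real (c k)))"
  have open_case: "?X \<le> discretization_bound h e + truncation_bound h M N" if e: "0 < e" "e < d" for e
  proof -
    define r where "r = max \<bar>a\<bar> \<bar>x\<bar>"
    define Q where "Q = (2 / cos (pi/2 * sin e)) powr \<nu>"
    define D where "D = 4 * e * (K * (pi/2) * Q * (1 + 1 / (\<mu> * (pi/2 * cos e)))) * (x - a)"
    define R where "R = (\<lambda>m::nat. (real m + 1/2) * h)"
    have R_lim: "filterlim (\<lambda>m. R m - r) at_top sequentially"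
      unfolding R_def using h by real_asymp
    have "((\<lambda>m. D / (R m - r)) \<longlongrightarrow> 0) sequentially"
      by (rule tendsto_divide_0[OF tendsto_const filterlim_at_top_imp_at_infinity[OF R_lim]])
    hence "((\<lambda>m. discretization_bound h e + D / (R m - r) / (2 * pi) + truncation_bound h M N)
        \<longlongrightarrow> discretization_bound h e + 0 / (2 * pi) + truncation_bound h M N) sequentially"
      by (intro tendsto_intros) auto
    moreover have "eventually (\<lambda>m. ?X \<le> discretization_bound h e + D / (R m - r) / (2 * pi) + truncation_bound h M N) sequentially"
      using filterlim_at_top_dense[THEN iffD1, OF R_lim, rule_format, of 0]
        eventually_ge_at_top[of "nat M"] eventually_ge_at_top[of "nat N"]
    proof eventually_elim
      case (elim m)
      let ?u = "\<lambda>k. g (of_real (of_int k * h)) * of_real (c k)"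
      have m: "M \<le> int m" "N \<le> int m" using elim by auto
      have "(\<Sum>k = - int m..int m. ?u k) = (\<Sum>k\<in>{- int m..int m} - {- M..N}. ?u k) + (\<Sum>k = - M..N. ?u k)"
        using m by (intro sum.subset_diff) auto
      hence "?X = norm ((integral {a..x} (\<lambda>t. g (of_real t)) - (\<Sum>k = - int m..int m. ?u k))
                   + (\<Sum>k\<in>{- int m..int m} - {- M..N}. ?u k))"
        by simp
      also have "\<dots> \<le> norm (integral {a..x} (\<lambda>t. g (of_real t)) - (\<Sum>k = - int m..int m. ?u k))
                   + norm (\<Sum>k\<in>{- int m..int m} - {- M..N}. ?u k)"
        by (rule norm_triangle_ineq)
      also have "norm (integral {a..x} (\<lambda>t. g (of_real t)) - (\<Sum>k = - int m..int m. ?u k))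
          \<le> discretization_bound h e + D / (R m - r) / (2 * pi)"
        unfolding c_def discretization_bound_def D_def Q_def
        by (rule sinc_rectangle_error) (use h e ax elim in \<open>auto simp: R_def r_def\<close>)
      also have "norm (\<Sum>k\<in>{- int m..int m} - {- M..N}. ?u k) \<le> truncation_bound h M N"
        unfolding truncation_bound_def
        using abs_integral_sinc_scaled_le[OF h, of a x] ax
        by (intro sinc_tail_le h MN m M N) (auto simp: c_def)
      finally show ?case by simp
    qed
    ultimately show ?thesis
      by (intro tendsto_lowerbound[where F = sequentially]) auto
  qed
  have cos_d: "cos d > 0" using d_pos d_lt by (intro cos_gt_zero_pi) auto
  have C_d: "cos (pi/2 * sin d) > 0" using d_pos d_lt by (intro cos_pi_half_sin_pos) auto
  have "isCont (\<lambda>e. discretization_bound h e) d"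
    unfolding discretization_bound_def
    using cos_d C_d d_pos h \<alpha>_pos \<beta>_pos by (intro continuous_intros) (auto simp: min_def)
  hence "((\<lambda>e. discretization_bound h e) \<longlongrightarrow> discretization_bound h d) (at_left d)"
    unfolding isCont_def by (rule filterlim_mono[OF _ order_refl at_le]) simp
  hence "((\<lambda>e. discretization_bound h e + truncation_bound h M N)
            \<longlongrightarrow> discretization_bound h d + truncation_bound h M N) (at_left d)"
    by (intro tendsto_intros)
  moreover have "eventually (\<lambda>e. ?X \<le> discretization_bound h e + truncation_bound h M N) (at_left d)"
    using eventually_at_left_real[OF d_pos] by eventually_elim (rule open_case, simp_all)
  ultimately show ?thesis
    by (intro tendsto_lowerbound[where F = "at_left d"]) auto
qed

text \<open>The preceding bound is uniform in \<open>a\<close>, so \<open>a\<close> may tend to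
  minus infinity, where the integrated cardinal functions become \<open>J k h\<close>.\<close>

lemma sinc_indefinite_error:
  fixes h \<tau> :: real and M N :: int
  assumes h: "h > 0" and MN: "0 \<le> M" "0 \<le> N"
    and M: "1 / (pi * \<alpha>) \<le> sinh (of_int M * h)" and N: "1 / (pi * \<beta>) \<le> sinh (of_int N * h)"
  shows "norm (integral {..\<tau>} (\<lambda>t. f (complex_of_real t))
             - (\<Sum>k\<in>{-M..N}. f (complex_of_real (psi_r (real_of_int k * h)))
                  * complex_of_real (deriv psi_r (real_of_int k * h) * J k h (psi_inv \<tau>))))
      \<le> discretization_bound h d + truncation_bound h M N"
proof -
  define x where "x = psi_inv \<tau>"
  let ?c = "\<lambda>a k. integral {a..x} (\<lambda>t. sinc (pi * (t/h - of_int k)))"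
  have "((\<lambda>a. ?c a k) \<longlongrightarrow> J k h x) at_bot" for k :: int
  proof -
    have "filterlim (\<lambda>a. pi * (a/h - of_int k)) at_bot at_bot" using h by real_asymp
    hence "((\<lambda>a. Si (pi * (a/h - of_int k))) \<longlongrightarrow> - (pi/2)) at_bot"
      by (rule filterlim_compose[OF Si_at_bot])
    hence "((\<lambda>a. h / pi * (Si (pi * (x/h - of_int k)) - Si (pi * (a/h - of_int k))))
        \<longlongrightarrow> h / pi * (Si (pi * (x/h - of_int k)) - (- (pi/2)))) at_bot"
      by (intro tendsto_intros)
    also have "h / pi * (Si (pi * (x/h - of_int k)) - (- (pi/2))) = J k h x"
      by (simp add: J_def field_simps)
    finally have lim: "((\<lambda>a. h / pi * (Si (pi * (x/h - of_int k)) - Si (pi * (a/h - of_int k)))) \<longlongrightarrow> J k h x) at_bot" .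
    have "eventually (\<lambda>a. h / pi * (Si (pi * (x/h - of_int k)) - Si (pi * (a/h - of_int k))) = ?c a k) at_bot"
      using eventually_le_at_bot[of x] by eventually_elim (simp only: integral_sinc_scaled[OF h])
    with lim show ?thesis by (rule Lim_transform_eventually)
  qed
  hence "((\<lambda>a. norm (integral {a..x} (\<lambda>t. g (of_real t)) - (\<Sum>k = - M..N. g (of_real (of_int k * h)) * of_real (?c a k))))
     \<longlongrightarrow> norm (integral {..psi_r x} (\<lambda>t. f (of_real t)) - (\<Sum>k = - M..N. g (of_real (of_int k * h)) * of_real (J k h x)))) at_bot"
    by (intro tendsto_norm tendsto_diff integral_f_limit tendsto_sum tendsto_mult tendsto_const tendsto_of_real)
  moreover have "eventually (\<lambda>a. norm (integral {a..x} (\<lambda>t. g (of_real t)) - (\<Sum>k = - M..N. g (of_real (of_int k * h)) * of_real (?c a k)))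
      \<le> discretization_bound h d + truncation_bound h M N) at_bot"
    using eventually_gt_at_bot[of x] by eventually_elim (rule sinc_finite_error[OF h _ MN M N])
  ultimately have "norm (integral {..psi_r x} (\<lambda>t. f (of_real t)) - (\<Sum>k = - M..N. g (of_real (of_int k * h)) * of_real (J k h x)))
      \<le> discretization_bound h d + truncation_bound h M N"
    by (intro tendsto_upperbound[where F = at_bot]) auto
  thus ?thesis
    unfolding x_def psi_r_psi_inv de_integrand_of_real mult.assoc of_real_mult[symmetric] .
qed

end

section \<open>The choice of step size\<close>

text \<open>With \<open>Z\<close> the exponent on the right, \<open>exp 1 * Z \<le> exp Z\<close>
  reduces the claim to \<open>1 \<le> exp 1 * (L - 1 + L * exp (- L))\<close>, an equality at
  \<open>L = 1\<close>. There \<open>1 - 1 / L\<close> vanishes and only the summand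
  \<open>pi * X * exp (- L)\<close> is left; in the application it is
  \<open>pi * \<mu> / 4\<close>.\<close>

lemma double_exponential_rate:
  fixes X L :: real
  assumes X: "X \<ge> 0" and L: "L \<ge> 1"
  shows "3 * X / L \<le> exp (pi * X * (1 - 1 / L) + pi * X * exp (- L))"
proof -
  define Z where "Z = pi * X * (1 - 1 / L) + pi * X * exp (- L)"
  have "2 - L \<le> exp (1 - L)" using exp_ge_add_one_self[of "1 - L"] by simp
  moreover have "(1::real) * (L - 1) \<le> exp 1 * (L - 1)"
    using L exp_ge_add_one_self[of 1] by (intro mult_right_mono) auto
  ultimately have "1 \<le> exp 1 * (L - 1) + exp (1 - L)" by simp
  also have "\<dots> \<le> exp 1 * (L - 1) + L * exp (1 - L)" using L by simp
  also have "\<dots> = exp 1 * (L - 1 + L * exp (- L))"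
    by (simp add: distrib_left exp_diff exp_minus field_simps)
  finally have 1: "1 \<le> exp 1 * (L - 1 + L * exp (- L))" .
  have "3 * X / L \<le> pi * X / L * 1"
    using X L pi_gt3 by (simp add: divide_right_mono mult_right_mono)
  also have "\<dots> \<le> pi * X / L * (exp 1 * (L - 1 + L * exp (- L)))"
    using X L by (intro mult_left_mono[OF 1]) auto
  also have "\<dots> = exp 1 * Z" using L by (simp add: Z_def field_simps)
  also have "\<dots> \<le> exp 1 * exp (Z - 1)"
    using exp_ge_add_one_self[of "Z - 1"] by (intro mult_left_mono) auto
  also have "\<dots> = exp Z" by (simp flip: exp_add)
  finally show ?thesis unfolding Z_def .
qed

context de_decay begin

context
  fixes n :: nat and h L :: real
  assumes n_pos: "n > 0" and n_large: "real n \<ge> \<nu> * exp 1 / (4 * d)"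
    and L: "L = ln (4 * d * n / \<mu>)" and h: "h = L / n"
begin

lemma dn_ge: "\<nu> * exp 1 \<le> 4 * (d * n)"
  using n_large d_pos by (simp add: field_simps)

lemma \<mu>_pos: "\<mu> > 0" using \<alpha>_pos \<beta>_pos by simp

lemma exp_L: "exp L = 4 * d * n / \<mu>"
  unfolding L using \<mu>_pos d_pos n_pos by simp

lemma L_ge_1: "L \<ge> 1"
proof -
  have "\<mu> * exp 1 \<le> \<nu> * exp 1" by (intro mult_right_mono) auto
  from order_trans[OF this dn_ge] have "exp 1 * \<mu> \<le> 4 * d * n" by (simp only: mult_ac)
  hence "exp 1 \<le> exp L" unfolding exp_L using \<mu>_pos by (simp only: pos_le_divide_eq)
  thus ?thesis by simp
qed

lemma h_pos: "h > 0" unfolding h using L_ge_1 n_pos by simp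

text \<open>Replacing \<open>sinh q\<close> by \<open>exp q / 2\<close> for
  \<open>q = pi * d / h\<close> costs the factor \<open>1 - exp (- (2 * q))\<close>, which is
  bounded below independently of \<open>n\<close>.\<close>

lemma discretization_bound_le:
  "discretization_bound h d \<le> 2 powr (\<nu> + 1) * K / (\<mu> * d) *
      (1 / ((1 - exp (- pi * \<mu> * exp 1 / 2)) * (cos (pi/2 * sin d)) powr \<nu> * cos d))
      * exp (- pi * d * n / L) * L / n"
proof -
  define q where "q = pi * d / h"
  define C where "C = cos (pi/2 * sin d)"
  define E where "E = 1 - exp (- pi * \<mu> * exp 1 / 2)"
  have cos_d: "cos d > 0" using d_pos d_lt by (intro cos_gt_zero_pi) auto
  have C: "C > 0" unfolding C_def using d_pos d_lt by (intro cos_pi_half_sin_pos) auto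
  have E: "E > 0" unfolding E_def using \<mu>_pos by simp
  have q: "q = pi * d * n / L" using n_pos by (simp add: q_def h)
  \<comment> \<open>Here \<open>2 * q\<close> equals \<open>pi * \<mu> / 2\<close> times
    \<open>exp L / L\<close>, whose minimum \<open>exp 1\<close> at \<open>L = 1\<close> is the
    \<open>exp 1\<close> of the constant.\<close>
  have "pi * \<mu> * exp 1 / 2 \<le> 2 * q"
  proof -
    have "L * exp 1 \<le> exp L"
      using exp_ge_add_one_self[of "L - 1"] by (simp add: exp_diff field_simps)
    hence "L * exp 1 * \<mu> \<le> 4 * (d * n)" unfolding exp_L using \<mu>_pos by (simp add: field_simps)
    hence "pi * (L * exp 1 * \<mu>) \<le> pi * (4 * (d * n))" by (intro mult_left_mono) auto
    thus ?thesis unfolding q using L_ge_1 by (simp add: field_simps)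
  qed
  hence "E \<le> 1 - exp (- (2 * q))" unfolding E_def by simp
  hence "exp q * E / 2 \<le> exp q * (1 - exp (- (2 * q))) / 2" by (intro divide_right_mono mult_left_mono) auto
  also have "\<dots> = sinh q"
    by (simp add: sinh_def right_diff_distrib flip: exp_add)
  finally have sinh: "exp q * E / 2 \<le> sinh q" .
  have sinh_q: "sinh q > 0" using d_pos h_pos by (simp add: q_def)
  have "discretization_bound h d = 2 * K * (2 / C) powr \<nu> / (\<mu> * cos d) * (h / d) / pi * (1 / sinh q)"
    by (simp add: discretization_bound_def C_def q_def)
  also have "\<dots> \<le> 2 * K * (2 / C) powr \<nu> / (\<mu> * cos d) * (h / d) / pi * (1 / (exp q * E / 2))"
    using sinh sinh_q E K_pos \<mu>_pos cos_d h_pos d_pos by (intro mult_left_mono divide_left_mono) auto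
  also have "\<dots> = 4 / pi * (K * (2 / C) powr \<nu> / (\<mu> * cos d) * (h / d) * (exp (- q) / E))"
    by (simp add: exp_minus field_simps)
  \<comment> \<open>Rounding \<open>4 / pi\<close> up to \<open>2\<close> leads to the exponent
    \<open>\<nu> + 1\<close>.\<close>
  also have "\<dots> \<le> 2 * (K * (2 / C) powr \<nu> / (\<mu> * cos d) * (h / d) * (exp (- q) / E))"
    using pi_gt3 E K_pos \<mu>_pos cos_d h_pos d_pos by (intro mult_right_mono) (auto simp: field_simps)
  also have "\<dots> = 2 powr (\<nu> + 1) * K / (\<mu> * d) * (1 / (E * C powr \<nu> * cos d)) * exp (- q) * h"
    using C by (simp add: powr_divide powr_add mult_ac)
  also have "- q = - pi * d * n / L" by (simp add: q)
  finally show ?thesis unfolding E_def C_def h by simp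
qed

text \<open>The bound on \<open>exp (P * h)\<close> makes the doubly exponential factor at most
  \<open>exp (- pi * d * n)\<close>, up to \<open>exp (pi * \<gamma> / 4)\<close> for the decaying
  half of \<open>sinh\<close>. The passage to the weaker rate of the claim is
  \<open>double_exponential_rate\<close> with \<open>X = d * n\<close>.\<close>

lemma truncation_term_le:
  assumes \<gamma>: "\<mu> \<le> \<gamma>" "\<gamma> \<le> \<nu>" and P: "0 \<le> P" "4 * d * n / \<gamma> \<le> exp (of_int P * h)"
  shows "3 * K * 2 powr \<gamma> / \<gamma> * exp (- (\<gamma> * (pi/2) * sinh (of_int P * h)))
      \<le> 2 powr \<nu> * K / (\<mu> * d) * exp (pi * (\<alpha> + \<beta>) / 4) * exp (- pi * d * n / L) * L / n"
proof -
  define X where "X = d * n"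
  have X: "X > 0" using d_pos n_pos by (simp add: X_def)
  have \<gamma>0: "\<gamma> > 0" using \<gamma> \<mu>_pos by linarith
  have sum: "\<alpha> + \<beta> = \<mu> + \<nu>" by (auto simp: min_def max_def)
  have \<mu>_eq: "\<mu> = 4 * X * exp (- L)"
    using exp_L \<mu>_pos X by (simp add: X_def exp_minus field_simps)
  have "exp (- (of_int P * h)) \<le> 1" using P h_pos by simp
  moreover have "2 * sinh (of_int P * h) = exp (of_int P * h) - exp (- (of_int P * h))"
    by (simp add: sinh_def)
  ultimately have "4 * d * n / \<gamma> - 1 \<le> 2 * sinh (of_int P * h)"
    using P(2) by linarith
  hence "\<gamma> * (4 * d * n / \<gamma> - 1) \<le> \<gamma> * (2 * sinh (of_int P * h))" using \<gamma>0 by (intro mult_left_mono) auto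
  hence "4 * X - \<gamma> \<le> 2 * \<gamma> * sinh (of_int P * h)" using \<gamma>0 by (simp add: X_def right_diff_distrib)
  hence "pi/4 * (4 * X - \<gamma>) \<le> pi/4 * (2 * \<gamma> * sinh (of_int P * h))" by (intro mult_left_mono) auto
  hence "- (\<gamma> * (pi/2) * sinh (of_int P * h)) \<le> - pi * X + pi/4 * \<gamma>" by (simp add: algebra_simps)
  also have "\<dots> \<le> - pi * X + pi/4 * \<nu>" using \<gamma> by simp
  finally have e1: "exp (- (\<gamma> * (pi/2) * sinh (of_int P * h))) \<le> exp (- pi * X + pi/4 * \<nu>)" by simp
  have p1: "2 powr \<gamma> / \<gamma> \<le> 2 powr \<nu> / \<mu>" using \<gamma> \<mu>_pos by (intro frac_le powr_mono) auto
  have "3 * K * 2 powr \<gamma> / \<gamma> * exp (- (\<gamma> * (pi/2) * sinh (of_int P * h)))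
     = 3 * K * (2 powr \<gamma> / \<gamma>) * exp (- (\<gamma> * (pi/2) * sinh (of_int P * h)))" by simp
  also have "\<dots> \<le> 3 * K * (2 powr \<nu> / \<mu>) * exp (- pi * X + pi/4 * \<nu>)"
    using e1 p1 K_pos \<gamma>0 \<mu>_pos by (intro mult_mono) auto
  \<comment> \<open>Writing \<open>3\<close> as \<open>(L / X) * (3 * X / L)\<close> splits off the
    factor \<open>L / n\<close> of the claim.\<close>
  also have "\<dots> = K * (2 powr \<nu> / \<mu>) * exp (- pi * X + pi/4 * \<nu>) * (L / X) * (3 * X / L)"
    using X L_ge_1 by simp
  also have "\<dots> \<le> K * (2 powr \<nu> / \<mu>) * exp (- pi * X + pi/4 * \<nu>) * (L / X) *
      exp (pi * X * (1 - 1 / L) + pi * X * exp (- L))"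
    using X L_ge_1 K_pos \<mu>_pos by (intro mult_left_mono double_exponential_rate) auto
  also have "\<dots> = K * (2 powr \<nu> / \<mu>) * (L / X) *
      exp (- pi * X + pi/4 * \<nu> + (pi * X * (1 - 1 / L) + pi * X * exp (- L)))"
    by (simp only: exp_add mult_ac)
  also have "- pi * X + pi/4 * \<nu> + (pi * X * (1 - 1 / L) + pi * X * exp (- L)) = pi * (\<alpha> + \<beta>) / 4 + (- pi * d * n / L)"
  proof -
    have "pi * X * exp (- L) = pi * \<mu> / 4" by (subst \<mu>_eq) simp
    thus ?thesis unfolding sum by (simp add: X_def algebra_simps add_divide_distrib)
  qed
  also have "K * (2 powr \<nu> / \<mu>) * (L / X) * exp (pi * (\<alpha> + \<beta>) / 4 + (- pi * d * n / L))
     = 2 powr \<nu> * K / (\<mu> * d) * exp (pi * (\<alpha> + \<beta>) / 4) * exp (- pi * d * n / L) * L / n"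
    unfolding exp_add X_def by (simp add: mult_ac)
  finally show ?thesis .
qed

lemma de_sinc_error:
  fixes M N :: int and \<tau> :: real
  assumes M: "xg (\<alpha>/2) \<le> of_int M * h" "4 * d * n / \<alpha> \<le> exp (of_int M * h)"
    and N: "xg (\<beta>/2) \<le> of_int N * h" "4 * d * n / \<beta> \<le> exp (of_int N * h)"
  shows "norm (integral {..\<tau>} (\<lambda>t. f (complex_of_real t))
             - (\<Sum>k\<in>{-M..N}. f (complex_of_real (psi_r (real_of_int k * h)))
                  * complex_of_real (deriv psi_r (real_of_int k * h) * J k h (psi_inv \<tau>))))
      \<le> 2 powr (\<nu> + 1) * K / (\<mu> * d) *
          (1 / ((1 - exp (- pi * \<mu> * exp 1 / 2)) * (cos (pi/2 * sin d)) powr \<nu> * cos d)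
           + exp (pi * (\<alpha> + \<beta>) / 4)) * exp (- pi * d * n / L) * L / n"
proof -
  \<comment> \<open>The threshold also settles the sign of the index, since \<open>sinh\<close> is
    positive at \<open>P * h\<close>.\<close>
  have node: "0 \<le> P \<and> 1 / (pi * \<gamma>) \<le> sinh (of_int P * h)"
    if \<gamma>: "\<gamma> > 0" and P: "xg (\<gamma>/2) \<le> of_int P * h" for P \<gamma>
  proof -
    have "1 / (2 * pi * (\<gamma>/2)) \<le> sinh (xg (\<gamma>/2))" using \<gamma> by (intro sinh_xg_ge) simp
    also have "\<dots> \<le> sinh (of_int P * h)" using P by simp
    finally have 1: "1 / (pi * \<gamma>) \<le> sinh (of_int P * h)" by simp
    moreover have "1 / (pi * \<gamma>) > 0" using \<gamma> by simp
    ultimately have "sinh (of_int P * h) > 0" by linarith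
    hence "0 < of_int P * h" by simp
    hence "0 \<le> P" using h_pos by (simp add: zero_less_mult_iff)
    with 1 show ?thesis by blast
  qed
  note M' = node[OF \<alpha>_pos M(1)] and N' = node[OF \<beta>_pos N(1)]
  have "norm (integral {..\<tau>} (\<lambda>t. f (complex_of_real t))
             - (\<Sum>k\<in>{-M..N}. f (complex_of_real (psi_r (real_of_int k * h)))
                  * complex_of_real (deriv psi_r (real_of_int k * h) * J k h (psi_inv \<tau>))))
     \<le> discretization_bound h d + truncation_bound h M N"
    using M' N' h_pos by (intro sinc_indefinite_error) auto
  also have "truncation_bound h M N \<le>
       2 powr \<nu> * K / (\<mu> * d) * exp (pi * (\<alpha> + \<beta>) / 4) * exp (- pi * d * n / L) * L / n
     + 2 powr \<nu> * K / (\<mu> * d) * exp (pi * (\<alpha> + \<beta>) / 4) * exp (- pi * d * n / L) * L / n"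
    unfolding truncation_bound_def
    using M' N' M(2) N(2) by (intro add_mono truncation_term_le) auto
  \<comment> \<open>The two ends carry \<open>2 powr \<nu>\<close> each and together reach the
    prefactor of the discretization error.\<close>
  also have "\<dots> = 2 powr (\<nu> + 1) * K / (\<mu> * d) * exp (pi * (\<alpha> + \<beta>) / 4) * exp (- pi * d * n / L) * L / n"
    by (simp add: powr_add mult_ac)
  also note discretization_bound_le
  finally show ?thesis
    by (simp only: distrib_left distrib_right add_divide_distrib)
qed

end

end

theorem theorem12:
  fixes f :: "complex \<Rightarrow> complex"
    and d K \<alpha> \<beta> :: real and n :: nat
  assumes d_pos: "0 < d" and d_lt: "d < pi/2"
    and f_an: "f analytic_on (psi ` strip d)"
    and K_pos: "K > 0" and \<alpha>_pos: "\<alpha> > 0" and \<beta>_pos: "\<beta> > 0"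
    and bound_minus: "\<And>z. z \<in> psi ` strip_minus d \<Longrightarrow>
                        norm (f z) \<le> K * norm (1 + z^2) powr (- (\<alpha> + 1) / 2)"
    and bound_plus: "\<And>z. z \<in> psi ` strip_plus d \<Longrightarrow>
                        norm (f z) \<le> K * norm (1 + z^2) powr (- (\<beta> + 1) / 2)"
    and n_pos: "n > 0"
    and n_large: "real n \<ge> max \<alpha> \<beta> * exp 1 / (4 * d)"
    and M_large: "real_of_int (let \<mu> = min \<alpha> \<beta>; h = ln (4*d*n/\<mu>) / n in
                    if \<mu> = \<alpha> then int n else int n - \<lfloor>ln (\<alpha>/\<beta>) / h\<rfloor>)
                  * (ln (4*d*n / min \<alpha> \<beta>) / n) \<ge> xg (\<alpha>/2)"
    and N_large: "real_of_int (let \<mu> = min \<alpha> \<beta>; h = ln (4*d*n/\<mu>) / n in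
                    if \<mu> = \<alpha> then int n - \<lfloor>ln (\<beta>/\<alpha>) / h\<rfloor> else int n)
                  * (ln (4*d*n / min \<alpha> \<beta>) / n) \<ge> xg (\<beta>/2)"
  shows "let \<mu> = min \<alpha> \<beta>; \<nu> = max \<alpha> \<beta>;
             h = ln (4*d*n/\<mu>) / n;
             M = (if \<mu> = \<alpha> then int n else int n - \<lfloor>ln (\<alpha>/\<beta>) / h\<rfloor>);
             N = (if \<mu> = \<alpha> then int n - \<lfloor>ln (\<beta>/\<alpha>) / h\<rfloor> else int n);
             C1 = 2 powr (\<nu> + 1) * K / (\<mu> * d) *
                  (1 / ((1 - exp (- pi * \<mu> * exp 1 / 2)) * (cos (pi/2 * sin d)) powr \<nu> * cos d)
                   + exp (pi * (\<alpha> + \<beta>) / 4))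
         in \<forall>\<tau>::real.
               norm (integral {..\<tau>} (\<lambda>t. f (complex_of_real t))
                 - (\<Sum>k\<in>{-M..N}. f (complex_of_real (psi_r (real_of_int k * h)))
                      * complex_of_real (deriv psi_r (real_of_int k * h) * J k h (psi_inv \<tau>))))
            \<le> C1 * exp (- pi * d * n / ln (4*d*n/\<mu>)) * ln (4*d*n/\<mu>) / n"
proof -
  interpret de_decay f d K \<alpha> \<beta>
    using assms by unfold_locales auto
  define L where "L = ln (4 * d * n / min \<alpha> \<beta>)"
  define h where "h = L / n"
  define M where "M = (if min \<alpha> \<beta> = \<alpha> then int n else int n - \<lfloor>ln (\<alpha>/\<beta>) / h\<rfloor>)"
  define N where "N = (if min \<alpha> \<beta> = \<alpha> then int n - \<lfloor>ln (\<beta>/\<alpha>) / h\<rfloor> else int n)"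
  note ctxt = n_pos n_large L_def h_def
  have h_pos: "h > 0" by (rule h_pos[OF ctxt])
  have nh: "real n * h = L" using n_pos by (simp add: h_def)
  have exp_L: "exp L = 4 * d * n / min \<alpha> \<beta>" by (rule exp_L[OF ctxt])
  \<comment> \<open>Rounding the shift down can only enlarge the index, so
    \<open>exp (n * h) = 4 * d * n / \<mu>\<close> is reduced at most by the factor
    \<open>\<gamma> / \<mu>\<close>.\<close>
  have shifted: "4 * d * n / \<gamma> \<le> exp (of_int (int n - \<lfloor>ln (\<gamma> / min \<alpha> \<beta>) / h\<rfloor>) * h)" if "\<gamma> > 0" for \<gamma>
  proof -
    have "of_int \<lfloor>ln (\<gamma> / min \<alpha> \<beta>) / h\<rfloor> * h \<le> ln (\<gamma> / min \<alpha> \<beta>)"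
      using of_int_floor_le by (rule iffD1[OF pos_le_divide_eq[OF h_pos]])
    hence "L - ln (\<gamma> / min \<alpha> \<beta>) \<le> of_int (int n - \<lfloor>ln (\<gamma> / min \<alpha> \<beta>) / h\<rfloor>) * h"
      using nh by (simp add: left_diff_distrib)
    hence "exp (L - ln (\<gamma> / min \<alpha> \<beta>)) \<le> exp (of_int (int n - \<lfloor>ln (\<gamma> / min \<alpha> \<beta>) / h\<rfloor>) * h)" by simp
    also have "exp (L - ln (\<gamma> / min \<alpha> \<beta>)) = 4 * d * n / \<gamma>"
      unfolding exp_diff exp_L using that \<alpha>_pos \<beta>_pos by simp
    finally show ?thesis .
  qed
  have unshifted: "4 * d * n / min \<alpha> \<beta> \<le> exp (of_int (int n) * h)"
    using nh exp_L by simp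
  have M: "xg (\<alpha>/2) \<le> of_int M * h" "4 * d * n / \<alpha> \<le> exp (of_int M * h)"
    using M_large shifted[OF \<alpha>_pos] unshifted unfolding M_def h_def L_def Let_def
    by (auto simp: min_def split: if_splits)
  have N: "xg (\<beta>/2) \<le> of_int N * h" "4 * d * n / \<beta> \<le> exp (of_int N * h)"
    using N_large shifted[OF \<beta>_pos] unshifted unfolding N_def h_def L_def Let_def
    by (auto simp: min_def split: if_splits)
  show ?thesis
    unfolding Let_def
    using de_sinc_error[OF ctxt M N] unfolding M_def N_def h_def L_def by blast
qed

end
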